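(* Let $(M,g)$ be a spacetime admitting a smooth temporal function $f : M \to \mathbb{R}$. Suppose there exist $t \in \mathbb{R}$ and $C > 0$ such that the level set $M_t = f^{-1}(t)$ is nonempty and the equality $g(\nabla f, \nabla f) = -C^2$ holds at every point of $M_t$. Then, for every $p,q \in M_t$, $$\hat{d}_f(p,q) \leq C\, d_{h_t}(p,q),$$ where $\hat{d}_f$ is the null distance associated with $f$, $h_t$ denotes the Riemannian metric induced by $g$ on the spacelike hypersurface $M_t$, and $d_{h_t}$ is the corresponding Riemannian distance function on $M_t$.
   Context: A Lorentzian manifold is a smooth manifold $M$ of dimension $n+1$ with a metric tensor $g$ of signature $(1,n)$ (one negative, $n$ positive directions). A nonzero tangent vector $X$ is timelike, null or spacelike if $g(X,X)$ is negative, zero or positive; causal means timelike or null. A time orientation is a smooth timelike vector field $\vartheta$; a causal vector $X$ is future-directed if $g(X,\vartheta)<0$ and past-directed if $g(X,\vartheta)>0$. A spacetime is a connected, time-oriented Lorentzian manifold. A smooth curve is causal if its tangent vector is everywhere causal; a causal curve is future-directed (past-directed) if its tangent vector is everywhere future-directed (past-directed). The gradient $\nabla f$ of a differentiable function $f$ is defined by $g(\nabla f, X) = \mathrm{d}f(X)$ for all tangent vectors $X$. A temporal function is a differentiable function $f : M\to\mathbb{R}$ whose gradient is everywhere past-directed timelike. A time function is a continuous function $\tau: M \to \mathbb{R}$ that is strictly increasing along all future-directed causal curves; every temporal function is a time function. If $f$ is a smooth temporal function, each nonempty level set $M_t=f^{-1}(t)$ is a spacelike hypersurface, and $h_t$ is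 the restriction of $g$ to it. A (continuous) curve $\beta : [a,b] \to M$ is piecewise causal if there is a partition $a = s_0 < \dots < s_N = b$ such that each restriction $\beta|_{[s_i,s_{i+1}]}$ is either a future-directed or a past-directed causal curve. For a time function $\tau$, the null length of $\beta$ is $\hat{L}_\tau(\beta) = \sum_{i=0}^{N-1} |\tau(\beta(s_{i+1})) - \tau(\beta(s_i))|$, and the null distance is $\hat{d}_\tau(p,q) = \inf\{\hat{L}_\tau(\beta) \mid \beta \text{ a piecewise causal curve from } p \text{ to } q\}$, with $\hat{d}_\tau(p,p)=0$. Distance functions are allowed to take the value $\infty$; $d_{h_t}(p,q)$ is the infimum of the $h_t$-lengths of curves in $M_t$ from $p$ to $q$ (equal to $\infty$ if $p,q$ lie in different connected components of $M_t$). *)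

theory Defs
  imports "HOL-Analysis.Analysis"
begin

section \<open>Smooth functions\<close>

(* Derivatives are taken within S, so that one definition serves for open S, where it is the usual
   notion, and for relatively open subsets S of a nondegenerate interval of reals, where it gives
   one-sided derivatives at the end points.  In both cases the derivative within S is unique. *)
primrec Ck_on :: "nat \<Rightarrow> 'b::real_normed_vector set \<Rightarrow> ('b \<Rightarrow> 'c::real_normed_vector) \<Rightarrow> bool" where
  "Ck_on 0 S f \<longleftrightarrow> continuous_on S f"
| "Ck_on (Suc k) S f \<longleftrightarrow> f differentiable_on S \<and>
     (\<forall>v. Ck_on k S (\<lambda>x. frechet_derivative f (at x within S) v))"

definition smooth_on :: "'b::real_normed_vector set \<Rightarrow> ('b \<Rightarrow> 'c::real_normed_vector) \<Rightarrow> bool" where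
  "smooth_on S f \<longleftrightarrow> (\<forall>k. Ck_on k S f)"


section \<open>Smooth manifolds\<close>

(* A chart is a pair of its domain and its coordinate map; values of the coordinate map outside
   the domain are irrelevant. *)
type_synonym ('a, 'e) chart = "'a set \<times> ('a \<Rightarrow> 'e)"

abbreviation chart_dom :: "('a, 'e) chart \<Rightarrow> 'a set" where
  "chart_dom \<phi> \<equiv> fst \<phi>"

abbreviation coords :: "('a, 'e) chart \<Rightarrow> 'a \<Rightarrow> 'e" where
  "coords \<phi> \<equiv> snd \<phi>"

definition chart_inv :: "('a, 'e) chart \<Rightarrow> 'e \<Rightarrow> 'a" where
  "chart_inv \<phi> = inv_into (chart_dom \<phi>) (coords \<phi>)"

definition is_chart :: "'a topology \<Rightarrow> ('a, 'e::euclidean_space) chart \<Rightarrow> bool" where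
  "is_chart M \<phi> \<longleftrightarrow> openin M (chart_dom \<phi>) \<and> open (coords \<phi> ` chart_dom \<phi>) \<and>
     homeomorphic_map (subtopology M (chart_dom \<phi>))
       (top_of_set (coords \<phi> ` chart_dom \<phi>)) (coords \<phi>)"

(* The atlas need not be maximal.  The dimension of the manifold is DIM('e). *)
definition smooth_manifold :: "'a topology \<Rightarrow> ('a, 'e::euclidean_space) chart set \<Rightarrow> bool" where
  "smooth_manifold M A \<longleftrightarrow> Hausdorff_space M \<and> second_countable M \<and>
     (\<forall>\<phi>\<in>A. is_chart M \<phi>) \<and> (\<Union>\<phi>\<in>A. chart_dom \<phi>) = topspace M \<and>
     (\<forall>\<phi>\<in>A. \<forall>\<psi>\<in>A. smooth_on (coords \<phi> ` (chart_dom \<phi> \<inter> chart_dom \<psi>)) (coords \<psi> \<circ> chart_inv \<phi>))"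

definition charts_at :: "('a, 'e) chart set \<Rightarrow> 'a \<Rightarrow> ('a, 'e) chart set" where
  "charts_at A p = {\<phi>\<in>A. p \<in> chart_dom \<phi>}"

(* A tangent vector at p is the family of its coordinate vectors in all charts around p,
   related to each other by the differentials of the transition maps; it is set to 0 at all
   other charts, so that vector operations and equality are pointwise. *)
type_synonym ('a, 'e) tvec = "('a, 'e) chart \<Rightarrow> 'e"

definition tangent_space :: "('a, 'e::euclidean_space) chart set \<Rightarrow> 'a \<Rightarrow> ('a, 'e) tvec set" where
  "tangent_space A p =
     {X. (\<forall>\<phi>\<in>charts_at A p. \<forall>\<psi>\<in>charts_at A p.
            X \<psi> = frechet_derivative (coords \<psi> \<circ> chart_inv \<phi>) (at (coords \<phi> p)) (X \<phi>)) \<and>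
         (\<forall>\<phi>. \<phi> \<notin> charts_at A p \<longrightarrow> X \<phi> = 0)}"

(* the tangent vector at p with coordinate vector v in the chart \<phi> *)
definition tvec_of :: "('a, 'e::euclidean_space) chart set \<Rightarrow> ('a, 'e) chart \<Rightarrow> 'a \<Rightarrow> 'e \<Rightarrow> ('a, 'e) tvec" where
  "tvec_of A \<phi> p v = (\<lambda>\<psi>. if \<psi> \<in> charts_at A p
     then frechet_derivative (coords \<psi> \<circ> chart_inv \<phi>) (at (coords \<phi> p)) v else 0)"

definition smooth_vector_field ::
    "'a topology \<Rightarrow> ('a, 'e::euclidean_space) chart set \<Rightarrow> ('a \<Rightarrow> ('a, 'e) tvec) \<Rightarrow> bool" where
  "smooth_vector_field M A V \<longleftrightarrow> (\<forall>p\<in>topspace M. V p \<in> tangent_space A p) \<and>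
     (\<forall>\<phi>\<in>A. smooth_on (coords \<phi> ` chart_dom \<phi>) (\<lambda>x. V (chart_inv \<phi> x) \<phi>))"

definition smooth_function :: "('a, 'e::euclidean_space) chart set \<Rightarrow> ('a \<Rightarrow> real) \<Rightarrow> bool" where
  "smooth_function A f \<longleftrightarrow> (\<forall>\<phi>\<in>A. smooth_on (coords \<phi> ` chart_dom \<phi>) (f \<circ> chart_inv \<phi>))"

definition differentiable_function :: "('a, 'e::euclidean_space) chart set \<Rightarrow> ('a \<Rightarrow> real) \<Rightarrow> bool" where
  "differentiable_function A f \<longleftrightarrow>
     (\<forall>\<phi>\<in>A. (f \<circ> chart_inv \<phi>) differentiable_on (coords \<phi> ` chart_dom \<phi>))"

(* By the chain rule the value does not depend on the chart selected. *)
definition differential ::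
    "('a, 'e::euclidean_space) chart set \<Rightarrow> ('a \<Rightarrow> real) \<Rightarrow> 'a \<Rightarrow> ('a, 'e) tvec \<Rightarrow> real" where
  "differential A f p X = (let \<phi> = (SOME \<phi>. \<phi> \<in> charts_at A p)
     in frechet_derivative (f \<circ> chart_inv \<phi>) (at (coords \<phi> p)) (X \<phi>))"


section \<open>Lorentzian manifolds and spacetimes\<close>

type_synonym ('a, 'e) metric = "'a \<Rightarrow> ('a, 'e) tvec \<Rightarrow> ('a, 'e) tvec \<Rightarrow> real"

(* Smoothness is smoothness of the components of g in every chart.  Signature (1, n): there is a
   g-orthonormal frame with exactly one negative vector.  Such vectors are automatically linearly
   independent, and there are n + 1 of them, so they form a basis. *)
definition lorentzian_manifold ::
    "nat \<Rightarrow> 'a topology \<Rightarrow> ('a, 'e::euclidean_space) chart set \<Rightarrow> ('a, 'e) metric \<Rightarrow> bool" where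
  "lorentzian_manifold n M A g \<longleftrightarrow> smooth_manifold M A \<and> DIM('e) = n + 1 \<and>
     (\<forall>p\<in>topspace M.
        (\<forall>X\<in>tangent_space A p. \<forall>Y\<in>tangent_space A p. g p X Y = g p Y X) \<and>
        (\<forall>X\<in>tangent_space A p. \<forall>Y\<in>tangent_space A p. \<forall>Z\<in>tangent_space A p. \<forall>a b.
           g p (\<lambda>\<phi>. a *\<^sub>R X \<phi> + b *\<^sub>R Y \<phi>) Z = a * g p X Z + b * g p Y Z) \<and>
        (\<exists>E. (\<forall>i\<le>n. E i \<in> tangent_space A p) \<and>
             (\<forall>i\<le>n. \<forall>j\<le>n. g p (E i) (E j) = (if i \<noteq> j then 0 else if i = 0 then -1 else 1)))) \<and>
     (\<forall>\<phi>\<in>A. \<forall>v w. smooth_on (coords \<phi> ` chart_dom \<phi>)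
        (\<lambda>x. let p = chart_inv \<phi> x in g p (tvec_of A \<phi> p v) (tvec_of A \<phi> p w)))"

definition timelike ::
    "('a, 'e::euclidean_space) chart set \<Rightarrow> ('a, 'e) metric \<Rightarrow> 'a \<Rightarrow> ('a, 'e) tvec \<Rightarrow> bool" where
  "timelike A g p X \<longleftrightarrow> X \<in> tangent_space A p \<and> X \<noteq> (\<lambda>_. 0) \<and> g p X X < 0"

definition causal ::
    "('a, 'e::euclidean_space) chart set \<Rightarrow> ('a, 'e) metric \<Rightarrow> 'a \<Rightarrow> ('a, 'e) tvec \<Rightarrow> bool" where
  "causal A g p X \<longleftrightarrow> X \<in> tangent_space A p \<and> X \<noteq> (\<lambda>_. 0) \<and> g p X X \<le> 0"

definition time_orientation ::
    "'a topology \<Rightarrow> ('a, 'e::euclidean_space) chart set \<Rightarrow> ('a, 'e) metric \<Rightarrow> ('a \<Rightarrow> ('a, 'e) tvec) \<Rightarrow> bool" where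
  "time_orientation M A g \<theta> \<longleftrightarrow>
     smooth_vector_field M A \<theta> \<and> (\<forall>p\<in>topspace M. timelike A g p (\<theta> p))"

definition spacetime ::
    "nat \<Rightarrow> 'a topology \<Rightarrow> ('a, 'e::euclidean_space) chart set \<Rightarrow> ('a, 'e) metric \<Rightarrow> ('a \<Rightarrow> ('a, 'e) tvec) \<Rightarrow> bool" where
  "spacetime n M A g \<theta> \<longleftrightarrow>
     lorentzian_manifold n M A g \<and> connected_space M \<and> time_orientation M A g \<theta>"

definition future_directed ::
    "('a, 'e) metric \<Rightarrow> ('a \<Rightarrow> ('a, 'e) tvec) \<Rightarrow> 'a \<Rightarrow> ('a, 'e) tvec \<Rightarrow> bool" where
  "future_directed g \<theta> p X \<longleftrightarrow> g p X (\<theta> p) < 0"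

definition past_directed ::
    "('a, 'e) metric \<Rightarrow> ('a \<Rightarrow> ('a, 'e) tvec) \<Rightarrow> 'a \<Rightarrow> ('a, 'e) tvec \<Rightarrow> bool" where
  "past_directed g \<theta> p X \<longleftrightarrow> g p X (\<theta> p) > 0"

definition gradient ::
    "('a, 'e::euclidean_space) chart set \<Rightarrow> ('a, 'e) metric \<Rightarrow> ('a \<Rightarrow> real) \<Rightarrow> 'a \<Rightarrow> ('a, 'e) tvec" where
  "gradient A g f p = (THE X. X \<in> tangent_space A p \<and>
     (\<forall>Y\<in>tangent_space A p. g p X Y = differential A f p Y))"

definition temporal_function ::
    "'a topology \<Rightarrow> ('a, 'e::euclidean_space) chart set \<Rightarrow> ('a, 'e) metric \<Rightarrow> ('a \<Rightarrow> ('a, 'e) tvec) \<Rightarrow>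
     ('a \<Rightarrow> real) \<Rightarrow> bool" where
  "temporal_function M A g \<theta> f \<longleftrightarrow> differentiable_function A f \<and>
     (\<forall>p\<in>topspace M. timelike A g p (gradient A g f p) \<and> past_directed g \<theta> p (gradient A g f p))"


section \<open>Curves and null distance\<close>

definition smooth_curve ::
    "'a topology \<Rightarrow> ('a, 'e::euclidean_space) chart set \<Rightarrow> real \<Rightarrow> real \<Rightarrow> (real \<Rightarrow> 'a) \<Rightarrow> bool" where
  "smooth_curve M A a b \<beta> \<longleftrightarrow> a < b \<and> continuous_map (top_of_set {a..b}) M \<beta> \<and>
     (\<forall>\<phi>\<in>A. smooth_on {u\<in>{a..b}. \<beta> u \<in> chart_dom \<phi>} (coords \<phi> \<circ> \<beta>))"

(* the tangent vector of the restriction of \<beta> to {a..b}, one-sided at the end points *)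
definition velocity ::
    "('a, 'e::euclidean_space) chart set \<Rightarrow> real \<Rightarrow> real \<Rightarrow> (real \<Rightarrow> 'a) \<Rightarrow> real \<Rightarrow> ('a, 'e) tvec" where
  "velocity A a b \<beta> u = (\<lambda>\<phi>. if \<phi> \<in> charts_at A (\<beta> u)
     then vector_derivative (coords \<phi> \<circ> \<beta>) (at u within {a..b}) else 0)"

definition causal_curve ::
    "'a topology \<Rightarrow> ('a, 'e::euclidean_space) chart set \<Rightarrow> ('a, 'e) metric \<Rightarrow> real \<Rightarrow> real \<Rightarrow> (real \<Rightarrow> 'a) \<Rightarrow> bool" where
  "causal_curve M A g a b \<beta> \<longleftrightarrow> smooth_curve M A a b \<beta> \<and>
     (\<forall>u\<in>{a..b}. causal A g (\<beta> u) (velocity A a b \<beta> u))"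

definition future_causal_curve ::
    "'a topology \<Rightarrow> ('a, 'e::euclidean_space) chart set \<Rightarrow> ('a, 'e) metric \<Rightarrow> ('a \<Rightarrow> ('a, 'e) tvec) \<Rightarrow>
     real \<Rightarrow> real \<Rightarrow> (real \<Rightarrow> 'a) \<Rightarrow> bool" where
  "future_causal_curve M A g \<theta> a b \<beta> \<longleftrightarrow> causal_curve M A g a b \<beta> \<and>
     (\<forall>u\<in>{a..b}. future_directed g \<theta> (\<beta> u) (velocity A a b \<beta> u))"

definition past_causal_curve ::
    "'a topology \<Rightarrow> ('a, 'e::euclidean_space) chart set \<Rightarrow> ('a, 'e) metric \<Rightarrow> ('a \<Rightarrow> ('a, 'e) tvec) \<Rightarrow>
     real \<Rightarrow> real \<Rightarrow> (real \<Rightarrow> 'a) \<Rightarrow> bool" where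
  "past_causal_curve M A g \<theta> a b \<beta> \<longleftrightarrow> causal_curve M A g a b \<beta> \<and>
     (\<forall>u\<in>{a..b}. past_directed g \<theta> (\<beta> u) (velocity A a b \<beta> u))"

(* s 0 < ... < s N is a partition of the interval {s 0..s N} *)
definition partition :: "nat \<Rightarrow> (nat \<Rightarrow> real) \<Rightarrow> bool" where
  "partition N s \<longleftrightarrow> 0 < N \<and> (\<forall>i<N. s i < s (Suc i))"

definition piecewise_causal ::
    "'a topology \<Rightarrow> ('a, 'e::euclidean_space) chart set \<Rightarrow> ('a, 'e) metric \<Rightarrow> ('a \<Rightarrow> ('a, 'e) tvec) \<Rightarrow>
     nat \<Rightarrow> (nat \<Rightarrow> real) \<Rightarrow> (real \<Rightarrow> 'a) \<Rightarrow> bool" where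
  "piecewise_causal M A g \<theta> N s \<beta> \<longleftrightarrow>
     partition N s \<and> continuous_map (top_of_set {s 0..s N}) M \<beta> \<and>
     (\<forall>i<N. future_causal_curve M A g \<theta> (s i) (s (Suc i)) \<beta> \<or>
            past_causal_curve M A g \<theta> (s i) (s (Suc i)) \<beta>)"

definition null_length :: "('a \<Rightarrow> real) \<Rightarrow> nat \<Rightarrow> (nat \<Rightarrow> real) \<Rightarrow> (real \<Rightarrow> 'a) \<Rightarrow> real" where
  "null_length \<tau> N s \<beta> = (\<Sum>i<N. \<bar>\<tau> (\<beta> (s (Suc i))) - \<tau> (\<beta> (s i))\<bar>)"

definition null_distance ::
    "'a topology \<Rightarrow> ('a, 'e::euclidean_space) chart set \<Rightarrow> ('a, 'e) metric \<Rightarrow> ('a \<Rightarrow> ('a, 'e) tvec) \<Rightarrow>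
     ('a \<Rightarrow> real) \<Rightarrow> 'a \<Rightarrow> 'a \<Rightarrow> ennreal" where
  "null_distance M A g \<theta> \<tau> p q = (if p = q then 0 else
     Inf {ennreal (null_length \<tau> N s \<beta>) | N s \<beta>.
       piecewise_causal M A g \<theta> N s \<beta> \<and> \<beta> (s 0) = p \<and> \<beta> (s N) = q})"


section \<open>Level sets and their Riemannian distance\<close>

definition level_set :: "'a topology \<Rightarrow> ('a \<Rightarrow> real) \<Rightarrow> real \<Rightarrow> 'a set" where
  "level_set M f t = {p\<in>topspace M. f p = t}"

(* the tangent space at p of the level set of f through p, for df nonzero at p *)
definition level_tangent_space ::
    "('a, 'e::euclidean_space) chart set \<Rightarrow> ('a \<Rightarrow> real) \<Rightarrow> 'a \<Rightarrow> ('a, 'e) tvec set" where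
  "level_tangent_space A f p = {X\<in>tangent_space A p. differential A f p X = 0}"

definition induced_metric ::
    "('a, 'e::euclidean_space) chart set \<Rightarrow> ('a, 'e) metric \<Rightarrow> ('a \<Rightarrow> real) \<Rightarrow> ('a, 'e) metric" where
  "induced_metric A g f p = (\<lambda>X\<in>level_tangent_space A f p. \<lambda>Y\<in>level_tangent_space A f p. g p X Y)"

(* The level set S of a temporal function is an embedded submanifold, so a smooth curve in S is the
   same as a smooth curve in M whose image lies in S. *)
definition piecewise_smooth_in ::
    "'a topology \<Rightarrow> ('a, 'e::euclidean_space) chart set \<Rightarrow> 'a set \<Rightarrow>
     nat \<Rightarrow> (nat \<Rightarrow> real) \<Rightarrow> (real \<Rightarrow> 'a) \<Rightarrow> bool" where
  "piecewise_smooth_in M A S N s \<gamma> \<longleftrightarrow>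
     partition N s \<and> continuous_map (top_of_set {s 0..s N}) M \<gamma> \<and> \<gamma> ` {s 0..s N} \<subseteq> S \<and>
     (\<forall>i<N. smooth_curve M A (s i) (s (Suc i)) \<gamma>)"

definition curve_length ::
    "('a, 'e::euclidean_space) chart set \<Rightarrow> ('a, 'e) metric \<Rightarrow> nat \<Rightarrow> (nat \<Rightarrow> real) \<Rightarrow> (real \<Rightarrow> 'a) \<Rightarrow> real" where
  "curve_length A h N s \<gamma> = (\<Sum>i<N. integral {s i..s (Suc i)}
     (\<lambda>u. sqrt (h (\<gamma> u) (velocity A (s i) (s (Suc i)) \<gamma> u) (velocity A (s i) (s (Suc i)) \<gamma> u))))"

definition riemannian_distance ::
    "'a topology \<Rightarrow> ('a, 'e::euclidean_space) chart set \<Rightarrow> 'a set \<Rightarrow> ('a, 'e) metric \<Rightarrow> 'a \<Rightarrow> 'a \<Rightarrow> ennreal" where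
  "riemannian_distance M A S h p q =
     Inf {ennreal (curve_length A h N s \<gamma>) | N s \<gamma>.
       piecewise_smooth_in M A S N s \<gamma> \<and> \<gamma> (s 0) = p \<and> \<gamma> (s N) = q}"

end

theory Submission
  imports Defs
begin

text \<open>
  A curve \<open>\<gamma>\<close> in the level set is shadowed by zigzag curves that run up along timelike lines to a
  slightly higher value of \<open>f\<close> and down again. Over a short parameter interval \<open>[u, v]\<close> with
  \<open>x \<in> [u, v]\<close> take a chart, let \<open>w\<close> be the difference quotient of \<open>\<gamma>\<close> in coordinates, and let \<open>N\<close> be
  a positive multiple \<open>\<mu> (- \<nabla>f)\<close> of the future-directed normal at \<open>\<gamma> x\<close>. The broken line through
  \<open>\<gamma> u\<close> with directions \<open>w + N\<close> and then \<open>w - N\<close>, each followed for half of the interval, ends at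
  \<open>\<gamma> v\<close>. At \<open>\<gamma> x\<close> the velocity of \<open>\<gamma>\<close> is orthogonal to \<open>\<nabla>f\<close> and \<open>g(N, N) = - \<mu>\<^sup>2 C\<^sup>2\<close>, so the two
  directions are timelike, one future- and one past-directed, as soon as \<open>\<mu> C\<close> exceeds the speed of
  \<open>\<gamma>\<close>. These are open conditions, hence they hold along both lines if the interval is short. On the
  way up \<open>f\<close> grows at rate about \<open>\<mu> C\<^sup>2\<close>, so the null length of the zigzag is about
  \<open>\<mu> C\<^sup>2 (v - u)\<close>, and this is as close as desired to \<open>C\<close> times the speed times \<open>v - u\<close>.

  Zigzags over adjacent intervals can be concatenated, and both sides of the estimate are additive.
  A Bolzano argument on the compact parameter interval therefore turns the local estimate
  (\<open>local_zigzag\<close>) into a piecewise causal curve with the same end points as \<open>\<gamma>\<close> and null length at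
  most \<open>C\<close> times the length of \<open>\<gamma>\<close> plus an arbitrarily small error
  (\<open>zigzag_along_smooth_curve\<close>). Taking the infimum over \<open>\<gamma>\<close> gives the theorem.

  Straight lines in a chart replace the flow of the gradient: their smoothness in every other chart
  needs only that a smooth map restricted to a line is smooth (\<open>Ck_on_line\<close>). The algebra behind the
  sign conditions is that of a Lorentzian scalar product on the coordinate space
  (\<open>timelike_not_orthogonal\<close>, \<open>same_time_cone\<close>).
\<close>

section \<open>Smooth functions along straight lines\<close>

lemma has_derivative_within_cong:
  assumes "\<And>x. x \<in> S \<Longrightarrow> f x = g x" and "x \<in> S"
  shows "(f has_derivative D) (at x within S) \<longleftrightarrow> (g has_derivative D) (at x within S)"
proof
  show "(g has_derivative D) (at x within S)" if "(f has_derivative D) (at x within S)"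
    by (rule has_derivative_transform[OF assms(2) _ that]) (simp add: assms(1))
  show "(f has_derivative D) (at x within S)" if "(g has_derivative D) (at x within S)"
    by (rule has_derivative_transform[OF assms(2) _ that]) (simp add: assms(1))
qed

lemma frechet_derivative_within_cong:
  assumes "\<And>x. x \<in> S \<Longrightarrow> f x = g x" and "x \<in> S"
  shows "frechet_derivative f (at x within S) = frechet_derivative g (at x within S)"
  unfolding frechet_derivative_def by (simp only: has_derivative_within_cong[OF assms])

lemma Ck_on_cong:
  assumes "\<And>x. x \<in> S \<Longrightarrow> f x = g x"
  shows "Ck_on k S f \<longleftrightarrow> Ck_on k S g"
  using assms
proof (induction k arbitrary: f g)
  case 0
  then show ?case
    by (simp cong: continuous_on_cong)
next
  case (Suc k)
  have "f differentiable_on S \<longleftrightarrow> g differentiable_on S"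
    unfolding differentiable_on_def differentiable_def
    by (intro ball_cong refl ex_cong1 has_derivative_within_cong Suc.prems)
  moreover have "Ck_on k S (\<lambda>x. frechet_derivative f (at x within S) v)
      \<longleftrightarrow> Ck_on k S (\<lambda>x. frechet_derivative g (at x within S) v)" for v
    by (rule Suc.IH) (simp add: frechet_derivative_within_cong[OF Suc.prems])
  ultimately show ?case
    by simp
qed

lemma smooth_on_cong:
  assumes "\<And>x. x \<in> S \<Longrightarrow> f x = g x"
  shows "smooth_on S f \<longleftrightarrow> smooth_on S g"
  unfolding smooth_on_def by (intro all_cong1 Ck_on_cong assms)

lemma has_derivative_unique_real:
  fixes f :: "real \<Rightarrow> 'b::real_normed_vector"
  assumes "at x within S \<noteq> bot"
    and "(f has_derivative D) (at x within S)" and "(f has_derivative D') (at x within S)"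
  shows "D = D'"
proof -
  have lin: "(\<lambda>h. h *\<^sub>R E 1) = E" if "(f has_derivative E) (at x within S)" for E
  proof
    show "h *\<^sub>R E 1 = E h" for h
      using linear_scale[OF has_derivative_linear[OF that], of h 1] by simp
  qed
  have vec: "(f has_vector_derivative E 1) (at x within S)"
    if "(f has_derivative E) (at x within S)" for E
    using that unfolding has_vector_derivative_def lin[OF that] .
  have "D = (\<lambda>h. h *\<^sub>R D 1)"
    by (rule lin[OF assms(2), symmetric])
  also have "D 1 = D' 1"
    by (rule vector_derivative_unique_within[OF assms(1) vec[OF assms(2)] vec[OF assms(3)]])
  also have "(\<lambda>h. h *\<^sub>R D' 1) = D'"
    by (rule lin[OF assms(3)])
  finally show ?thesis .
qed

text \<open>The derivative of \<open>u \<mapsto> F (y + u w)\<close> in the direction \<open>h\<close> is the derivative of \<open>F\<close> in the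
  fixed direction \<open>h w\<close> along the same line, so the differentiability class is inherited by
  induction without a product rule. The hypothesis on \<open>S\<close> makes derivatives within \<open>S\<close> unique.\<close>

lemma Ck_on_line:
  fixes F :: "'b::real_normed_vector \<Rightarrow> 'c::real_normed_vector" and S :: "real set"
  assumes "open U" and "\<And>u. u \<in> S \<Longrightarrow> y + u *\<^sub>R w \<in> U"
    and "\<And>u. u \<in> S \<Longrightarrow> at u within S \<noteq> bot"
    and "Ck_on k U F"
  shows "Ck_on k S (\<lambda>u. F (y + u *\<^sub>R w))"
  using assms(4)
proof (induction k arbitrary: F)
  case 0
  have "continuous_on S (\<lambda>u. y + u *\<^sub>R w)"
    by (intro continuous_intros)
  with 0 show ?case
    using assms(2) by (auto intro: continuous_on_compose2)
next
  case (Suc k)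
  let ?D = "\<lambda>x. frechet_derivative F (at x within U)"
  have der: "((\<lambda>u. F (y + u *\<^sub>R w)) has_derivative (\<lambda>h. ?D (y + u *\<^sub>R w) (h *\<^sub>R w))) (at u within S)"
    if "u \<in> S" for u
  proof -
    have "(F has_derivative ?D (y + u *\<^sub>R w)) (at (y + u *\<^sub>R w) within U)"
      using Suc.prems assms(2)[OF that] frechet_derivative_works
      by (auto simp: differentiable_on_def)
    then have "(F has_derivative ?D (y + u *\<^sub>R w)) (at (y + u *\<^sub>R w))"
      using at_within_open[OF assms(2)[OF that] assms(1)] by simp
    moreover have "((\<lambda>u. y + u *\<^sub>R w) has_derivative (\<lambda>h. h *\<^sub>R w)) (at u within S)"
      by (auto intro!: derivative_eq_intros)
    ultimately show ?thesis
      using has_derivative_compose by blast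
  qed
  have "Ck_on k S (\<lambda>u. frechet_derivative (\<lambda>u. F (y + u *\<^sub>R w)) (at u within S) h)" for h
  proof -
    have "Ck_on k S (\<lambda>u. ?D (y + u *\<^sub>R w) (h *\<^sub>R w))"
      using Suc.prems by (intro Suc.IH) simp
    moreover have "frechet_derivative (\<lambda>u. F (y + u *\<^sub>R w)) (at u within S) h
        = ?D (y + u *\<^sub>R w) (h *\<^sub>R w)" if "u \<in> S" for u
    proof -
      have "((\<lambda>u. F (y + u *\<^sub>R w)) has_derivative
          frechet_derivative (\<lambda>u. F (y + u *\<^sub>R w)) (at u within S)) (at u within S)"
        using differentiableI[OF der[OF that]] by (simp only: frechet_derivative_works)
      from has_derivative_unique_real[OF assms(3)[OF that] this der[OF that]]
      show ?thesis by (rule fun_cong)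
    qed
    ultimately show ?thesis
      by (subst Ck_on_cong) assumption+
  qed
  moreover have "(\<lambda>u. F (y + u *\<^sub>R w)) differentiable_on S"
    unfolding differentiable_on_def using der differentiableI by blast
  ultimately show ?case
    by simp
qed

lemma smooth_on_continuous_frechet_derivative:
  assumes "smooth_on S f"
  shows "continuous_on S (\<lambda>x. frechet_derivative f (at x within S) v)"
proof -
  have "Ck_on (Suc 0) S f"
    using assms by (simp add: smooth_on_def del: Ck_on.simps)
  then show ?thesis by simp
qed

lemma smooth_on_has_derivative:
  assumes "smooth_on S f" and "x \<in> S"
  shows "(f has_derivative frechet_derivative f (at x within S)) (at x within S)"
proof -
  have "Ck_on (Suc 0) S f"
    using assms by (simp add: smooth_on_def del: Ck_on.simps)
  then show ?thesis
    using assms(2) frechet_derivative_works by (auto simp: differentiable_on_def)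
qed

lemma smooth_on_continuous_on:
  assumes "smooth_on S f"
  shows "continuous_on S f"
proof -
  have "Ck_on 0 S f"
    using assms unfolding smooth_on_def by blast
  then show ?thesis by simp
qed

text \<open>A derivative depends linearly on the direction, so continuity in the point for each fixed
  direction gives continuity in both variables.\<close>

lemma tendsto_frechet_derivative:
  fixes F :: "'e::euclidean_space \<Rightarrow> real"
  assumes "open U" and "smooth_on U F" and "y \<in> U"
    and "(Y \<longlongrightarrow> y) G" and "(V \<longlongrightarrow> v) G"
  shows "((\<lambda>k. frechet_derivative F (at (Y k)) (V k)) \<longlongrightarrow> frechet_derivative F (at y) v) G"
proof -
  let ?D = "\<lambda>x. frechet_derivative F (at x)"
  have exp: "?D x z = (\<Sum>i\<in>Basis. (z \<bullet> i) * ?D x i)" if "x \<in> U" for x z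
  proof -
    have "(F has_derivative ?D x) (at x)"
      using smooth_on_has_derivative[OF assms(2) that] at_within_open[OF that assms(1)] by simp
    then have lin: "linear (?D x)"
      by (rule has_derivative_linear)
    have "?D x z = ?D x (\<Sum>i\<in>Basis. (z \<bullet> i) *\<^sub>R i)"
      by (simp add: euclidean_representation)
    then show ?thesis
      by (simp add: linear_sum[OF lin] linear_scale[OF lin])
  qed
  have "isCont (\<lambda>x. ?D x i) y" for i
  proof -
    have "continuous_on U (\<lambda>x. frechet_derivative F (at x within U) i)"
      using assms(2) by (rule smooth_on_continuous_frechet_derivative)
    then have "continuous_on U (\<lambda>x. ?D x i)"
      by (rule continuous_on_eq) (simp add: at_within_open[OF _ assms(1)])
    then show ?thesis
      unfolding continuous_on_eq_continuous_at[OF assms(1)] using assms(3) by blast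
  qed
  then have "((\<lambda>k. ?D (Y k) i) \<longlongrightarrow> ?D y i) G" for i
    using assms(4) by (rule isCont_tendsto_compose)
  then have "((\<lambda>k. \<Sum>i\<in>Basis. (V k \<bullet> i) * ?D (Y k) i) \<longlongrightarrow> (\<Sum>i\<in>Basis. (v \<bullet> i) * ?D y i)) G"
    by (intro tendsto_intros assms(5))
  moreover have "\<forall>\<^sub>F k in G. Y k \<in> U"
    using topological_tendstoD[OF assms(4,1,3)] .
  then have "\<forall>\<^sub>F k in G. (\<Sum>i\<in>Basis. (V k \<bullet> i) * ?D (Y k) i) = ?D (Y k) (V k)"
    by (rule eventually_mono) (rule exp[symmetric])
  ultimately have "((\<lambda>k. ?D (Y k) (V k)) \<longlongrightarrow> (\<Sum>i\<in>Basis. (v \<bullet> i) * ?D y i)) G"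
    by (rule Lim_transform_eventually)
  then show ?thesis
    unfolding exp[OF assms(3), of v] .
qed


section \<open>Lorentzian scalar products\<close>

locale lorentz_form =
  fixes B :: "'e::euclidean_space \<Rightarrow> 'e \<Rightarrow> real" and n :: nat and e :: "nat \<Rightarrow> 'e"
  assumes dimension: "DIM('e) = n + 1"
    and bilinear: "bilinear B"
    and sym: "B v w = B w v"
    and frame: "i \<le> n \<Longrightarrow> j \<le> n \<Longrightarrow> B (e i) (e j) = (if i \<noteq> j then 0 else if i = 0 then -1 else 1)"
begin

abbreviation sign :: "nat \<Rightarrow> real" where
  "sign i \<equiv> (if i = 0 then -1 else 1)"

lemmas B_simps =
  bilinear_ladd[OF bilinear] bilinear_radd[OF bilinear] bilinear_lmul[OF bilinear]
  bilinear_rmul[OF bilinear] bilinear_lneg[OF bilinear] bilinear_rneg[OF bilinear]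
  bilinear_lsub[OF bilinear] bilinear_rsub[OF bilinear]

lemma sum_left: "B (\<Sum>i\<in>I. x i *\<^sub>R z i) w = (\<Sum>i\<in>I. x i * B (z i) w)"
proof -
  have lin: "linear (\<lambda>v. B v w)"
    using bilinear by (simp add: bilinear_def)
  show ?thesis
    by (simp add: linear_sum[OF lin] linear_scale[OF lin])
qed

lemma B_combination:
  assumes "j \<le> n"
  shows "B (\<Sum>i\<le>n. x i *\<^sub>R e i) (e j) = sign j * x j"
proof -
  have "B (\<Sum>i\<le>n. x i *\<^sub>R e i) (e j) = (\<Sum>i\<le>n. x i * B (e i) (e j))"
    by (rule sum_left)
  also have "\<dots> = (\<Sum>i\<le>n. if i = j then sign j * x j else 0)"
    using assms by (intro sum.cong) (auto simp: frame)
  also have "\<dots> = sign j * x j"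
    using assms by simp
  finally show ?thesis .
qed

text \<open>The frame is linearly independent because the coefficients of a combination can be read
  off by pairing with the frame; by the dimension it is a basis.\<close>

lemma expansion: "v = (\<Sum>i\<le>n. (sign i * B v (e i)) *\<^sub>R e i)"
proof -
  have inj: "inj_on e {..n}"
  proof (rule inj_onI)
    fix i j assume "i \<in> {..n}" "j \<in> {..n}" "e i = e j"
    then show "i = j"
      using frame[of i i] frame[of i j] by (auto split: if_splits)
  qed
  have "independent (e ` {..n})"
  proof (rule independent_if_scalars_zero)
    fix c v assume 0: "(\<Sum>x\<in>e ` {..n}. c x *\<^sub>R x) = 0" and "v \<in> e ` {..n}"
    then obtain j where j: "j \<le> n" "v = e j" by auto
    have "(\<Sum>i\<le>n. c (e i) *\<^sub>R e i) = 0"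
      using 0 by (simp add: sum.reindex[OF inj])
    then have "sign j * c (e j) = B 0 (e j)"
      using B_combination[OF j(1), of "\<lambda>i. c (e i)"] by simp
    then show "c v = 0"
      using j(2) bilinear_lzero[OF bilinear] by (auto split: if_splits)
  qed simp
  then have "dim (e ` {..n}) = DIM('e)"
    by (simp add: dim_eq_card_independent card_image[OF inj] dimension)
  then have "v \<in> span (e ` {..n})"
    by (simp only: dim_eq_full) simp
  then obtain c where "v = (\<Sum>x\<in>e ` {..n}. c x *\<^sub>R x)"
    by (auto simp: span_finite)
  then have v: "v = (\<Sum>i\<le>n. c (e i) *\<^sub>R e i)"
    by (simp add: sum.reindex[OF inj])
  have "sign j * B v (e j) = c (e j)" if "j \<le> n" for j
    using B_combination[OF that, of "\<lambda>i. c (e i)"] v by simp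
  then have "(\<Sum>i\<le>n. (sign i * B v (e i)) *\<^sub>R e i) = (\<Sum>i\<le>n. c (e i) *\<^sub>R e i)"
    by (intro sum.cong) auto
  then show ?thesis
    using v by simp
qed

lemma parseval: "B v w = (\<Sum>i\<le>n. sign i * B v (e i) * B w (e i))"
proof -
  have "B v w = B (\<Sum>i\<le>n. (sign i * B v (e i)) *\<^sub>R e i) w"
    by (simp only: expansion[of v, symmetric])
  then show ?thesis
    by (simp only: sum_left sym[of w])
qed

lemma parseval_split:
  "B v w = (\<Sum>i=1..n. B v (e i) * B w (e i)) - B v (e 0) * B w (e 0)"
proof -
  have "{..n} = insert 0 {1..n}" by auto
  then show ?thesis
    using parseval[of v w] by (simp add: sum_negf)
qed

lemma representation:
  assumes "linear l"
  shows "\<exists>!v. \<forall>w. B v w = l w"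
proof (rule ex1I)
  let ?v = "\<Sum>i\<le>n. (sign i * l (e i)) *\<^sub>R e i"
  have "B ?v w = l w" for w
  proof -
    have "B ?v w = (\<Sum>i\<le>n. sign i * B ?v (e i) * B w (e i))"
      by (rule parseval)
    also have "\<dots> = (\<Sum>i\<le>n. (sign i * B w (e i)) * l (e i))"
      by (intro sum.cong) (auto simp: B_combination)
    also have "\<dots> = l (\<Sum>i\<le>n. (sign i * B w (e i)) *\<^sub>R e i)"
      by (simp add: linear_sum[OF assms] linear_scale[OF assms])
    also have "\<dots> = l w"
      by (simp only: expansion[of w, symmetric])
    finally show ?thesis .
  qed
  then show "\<forall>w. B ?v w = l w" by simp
next
  fix v assume v: "\<forall>w. B v w = l w"
  have "v = (\<Sum>i\<le>n. (sign i * B v (e i)) *\<^sub>R e i)"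
    by (rule expansion)
  also have "\<dots> = (\<Sum>i\<le>n. (sign i * l (e i)) *\<^sub>R e i)"
    by (simp only: v)
  finally show "v = (\<Sum>i\<le>n. (sign i * l (e i)) *\<^sub>R e i)" .
qed

text \<open>In the frame a timelike vector has time component larger than the length of its spatial
  part, so the Cauchy-Schwarz inequality for the spatial parts keeps the scalar product of two
  timelike vectors away from zero.\<close>

lemma timelike_not_orthogonal:
  assumes "B v v < 0" and "B w w < 0"
  shows "B v w \<noteq> 0"
proof
  assume "B v w = 0"
  define P Q R where "P = (\<Sum>i=1..n. (B v (e i))\<^sup>2)" and "Q = (\<Sum>i=1..n. (B w (e i))\<^sup>2)"
    and "R = (\<Sum>i=1..n. B v (e i) * B w (e i))"
  have "R\<^sup>2 \<le> P * Q"
    unfolding P_def Q_def R_def by (rule Cauchy_Schwarz_ineq_sum)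
  moreover have "R = B v (e 0) * B w (e 0)"
    using \<open>B v w = 0\<close> parseval_split[of v w] by (simp add: R_def)
  moreover have "P < (B v (e 0))\<^sup>2" "Q < (B w (e 0))\<^sup>2"
    using assms parseval_split[of v v] parseval_split[of w w]
    by (simp_all add: P_def Q_def power2_eq_square)
  moreover have "0 \<le> P" "0 \<le> Q"
    by (simp_all add: P_def Q_def sum_nonneg)
  ultimately show False
    using mult_strict_mono'[of P "(B v (e 0))\<^sup>2" Q "(B w (e 0))\<^sup>2"] by (simp add: power_mult_distrib)
qed

lemma orthogonal_to_timelike:
  assumes "B N N < 0" and "B w N = 0"
  shows "B w w \<ge> 0"
  using assms timelike_not_orthogonal[of w N] by force

text \<open>The vector \<open>w\<close> is orthogonal to \<open>N\<close> and hence not timelike, so \<open>s w + N\<close> is timelike for all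
  \<open>s\<close> between \<open>0\<close> and \<open>1\<close>. On this segment the scalar product with \<open>T\<close> has no zero and keeps its
  sign.\<close>

lemma same_time_cone:
  assumes "B N N < 0" and "B T T < 0" and "B N T < 0" and "B w N = 0" and "B (w + N) (w + N) < 0"
  shows "B (w + N) T < 0"
proof (rule ccontr)
  assume "\<not> ?thesis"
  then have *: "B w T \<ge> - B N T" by (simp add: B_simps)
  define s where "s = - B N T / B w T"
  have s: "0 \<le> s" "s \<le> 1" "s * B w T = - B N T"
    using * assms(3) by (auto simp: s_def field_simps)
  have ww: "B w w + B N N < 0"
    using assms(4,5) sym[of w N] by (simp add: B_simps)
  have "s\<^sup>2 * B w w \<le> B w w"
    using s orthogonal_to_timelike[OF assms(1,4)] by (simp add: mult_left_le_one_le power_le_one)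
  then have "B (s *\<^sub>R w + N) (s *\<^sub>R w + N) < 0"
    using assms(4) sym[of w N] ww by (simp add: B_simps power2_eq_square)
  moreover have "B (s *\<^sub>R w + N) T = 0"
    using s(3) by (simp add: B_simps)
  ultimately show False
    using timelike_not_orthogonal assms(2) by blast
qed

end


section \<open>Charts, tangent vectors and curves\<close>

locale manifold =
  fixes M :: "'a topology" and A :: "('a, 'e::euclidean_space) chart set"
  assumes smooth_manifold: "smooth_manifold M A"
begin

abbreviation chart_range :: "('a, 'e) chart \<Rightarrow> 'e set" where
  "chart_range \<phi> \<equiv> coords \<phi> ` chart_dom \<phi>"

lemma chart:
  assumes "\<phi> \<in> A"
  shows openin_chart_dom: "openin M (chart_dom \<phi>)"
    and open_chart_range: "open (chart_range \<phi>)"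
    and homeomorphic_coords:
      "homeomorphic_map (subtopology M (chart_dom \<phi>)) (top_of_set (chart_range \<phi>)) (coords \<phi>)"
  using smooth_manifold assms by (auto simp: smooth_manifold_def is_chart_def)

lemma topspace_chart:
  assumes "\<phi> \<in> A"
  shows "topspace (subtopology M (chart_dom \<phi>)) = chart_dom \<phi>"
  using openin_subset[OF openin_chart_dom[OF assms]] by auto

lemma chart_inv_coords:
  assumes "\<phi> \<in> A" and "p \<in> chart_dom \<phi>"
  shows "chart_inv \<phi> (coords \<phi> p) = p"
proof -
  have "inj_on (coords \<phi>) (chart_dom \<phi>)"
    using homeomorphic_imp_injective_map[OF homeomorphic_coords[OF assms(1)]]
    by (simp only: topspace_chart[OF assms(1)])
  then show ?thesis
    using assms(2) by (simp add: chart_inv_def)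
qed

lemma coords_chart_inv:
  assumes "y \<in> chart_range \<phi>"
  shows "coords \<phi> (chart_inv \<phi> y) = y"
  using assms unfolding chart_inv_def by (rule f_inv_into_f)

lemma chart_inv_in_dom:
  assumes "y \<in> chart_range \<phi>"
  shows "chart_inv \<phi> y \<in> chart_dom \<phi>"
  using assms unfolding chart_inv_def by (rule inv_into_into)

lemma continuous_chart_inv:
  assumes "\<phi> \<in> A"
  shows "continuous_map (top_of_set (chart_range \<phi>)) M (chart_inv \<phi>)"
proof -
  obtain h where h: "homeomorphic_maps (subtopology M (chart_dom \<phi>)) (top_of_set (chart_range \<phi>)) (coords \<phi>) h"
    using homeomorphic_coords[OF assms] by (auto simp: homeomorphic_map_maps)
  then have "continuous_map (top_of_set (chart_range \<phi>)) (subtopology M (chart_dom \<phi>)) h"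
    by (simp add: homeomorphic_maps_def)
  then have "continuous_map (top_of_set (chart_range \<phi>)) M h"
    by (rule continuous_map_into_fulltopology)
  moreover have "h y = chart_inv \<phi> y" if y: "y \<in> chart_range \<phi>" for y
  proof -
    have "h (coords \<phi> (chart_inv \<phi> y)) = chart_inv \<phi> y"
      using h chart_inv_in_dom[OF y] topspace_chart[OF assms]
      by (metis homeomorphic_maps_def)
    then show ?thesis
      by (simp only: coords_chart_inv[OF y])
  qed
  ultimately show ?thesis
    by (rule continuous_map_eq) simp
qed

lemma open_overlap:
  assumes "\<phi> \<in> A" and "\<psi> \<in> A"
  shows "open (coords \<phi> ` (chart_dom \<phi> \<inter> chart_dom \<psi>))"
proof -
  have "openin (subtopology M (chart_dom \<phi>)) (chart_dom \<phi> \<inter> chart_dom \<psi>)"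
    using openin_chart_dom[OF assms(2)] by (rule openin_subtopology_Int2)
  then have "openin (top_of_set (chart_range \<phi>)) (coords \<phi> ` (chart_dom \<phi> \<inter> chart_dom \<psi>))"
    using homeomorphic_imp_open_map[OF homeomorphic_coords[OF assms(1)]] by (simp add: open_map_def)
  then show ?thesis
    using open_chart_range[OF assms(1)] by (simp add: openin_open_eq)
qed

lemma transition_smooth:
  assumes "\<phi> \<in> A" and "\<psi> \<in> A"
  shows "smooth_on (coords \<phi> ` (chart_dom \<phi> \<inter> chart_dom \<psi>)) (coords \<psi> \<circ> chart_inv \<phi>)"
  using smooth_manifold assms by (simp add: smooth_manifold_def)

lemma transition_has_derivative:
  assumes "\<phi> \<in> charts_at A p" and "\<psi> \<in> charts_at A p"
  shows "((coords \<psi> \<circ> chart_inv \<phi>) has_derivative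
    frechet_derivative (coords \<psi> \<circ> chart_inv \<phi>) (at (coords \<phi> p))) (at (coords \<phi> p))"
proof -
  have A: "\<phi> \<in> A" "\<psi> \<in> A" and p: "coords \<phi> p \<in> coords \<phi> ` (chart_dom \<phi> \<inter> chart_dom \<psi>)"
    using assms by (auto simp: charts_at_def)
  show ?thesis
    using smooth_on_has_derivative[OF transition_smooth[OF A] p]
    by (simp only: at_within_open[OF p open_overlap[OF A]])
qed

text \<open>Near \<open>coords \<psi> p\<close> the coordinate expression of \<open>k\<close> in \<open>\<psi>\<close> factors through the transition map to
  \<open>\<phi>\<close>. With a coordinate map for \<open>k\<close> this is the cocycle rule for transition maps, with a real
  function the independence of its differential from the chart.\<close>

lemma has_derivative_change_chart:
  assumes "\<phi> \<in> charts_at A p" and "\<psi> \<in> charts_at A p"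
    and "((k \<circ> chart_inv \<phi>) has_derivative D) (at (coords \<phi> p))"
  shows "((k \<circ> chart_inv \<psi>) has_derivative
    (\<lambda>v. D (frechet_derivative (coords \<phi> \<circ> chart_inv \<psi>) (at (coords \<psi> p)) v))) (at (coords \<psi> p))"
proof -
  have A: "\<phi> \<in> A" "\<psi> \<in> A" "p \<in> chart_dom \<phi>" "p \<in> chart_dom \<psi>"
    using assms by (auto simp: charts_at_def)
  have "(coords \<phi> \<circ> chart_inv \<psi>) (coords \<psi> p) = coords \<phi> p"
    using chart_inv_coords[OF A(2,4)] by simp
  then have "((\<lambda>y. (k \<circ> chart_inv \<phi>) ((coords \<phi> \<circ> chart_inv \<psi>) y)) has_derivative
      (\<lambda>v. D (frechet_derivative (coords \<phi> \<circ> chart_inv \<psi>) (at (coords \<psi> p)) v))) (at (coords \<psi> p))"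
    using has_derivative_compose[OF transition_has_derivative[OF assms(2,1)], of "k \<circ> chart_inv \<phi>" D]
      assms(3) by (simp only:)
  then show ?thesis
  proof (rule has_derivative_transform_within_open)
    show "open (coords \<psi> ` (chart_dom \<psi> \<inter> chart_dom \<phi>))"
      using A by (intro open_overlap)
    show "coords \<psi> p \<in> coords \<psi> ` (chart_dom \<psi> \<inter> chart_dom \<phi>)"
      using A by auto
    show "(k \<circ> chart_inv \<phi>) ((coords \<phi> \<circ> chart_inv \<psi>) y) = (k \<circ> chart_inv \<psi>) y"
      if "y \<in> coords \<psi> ` (chart_dom \<psi> \<inter> chart_dom \<phi>)" for y
      using that A by (auto simp: chart_inv_coords)
  qed
qed

lemma frechet_derivative_change_chart:
  assumes "\<phi> \<in> charts_at A p" and "\<psi> \<in> charts_at A p"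
    and "((k \<circ> chart_inv \<phi>) has_derivative D) (at (coords \<phi> p))"
  shows "frechet_derivative (k \<circ> chart_inv \<psi>) (at (coords \<psi> p)) v
    = D (frechet_derivative (coords \<phi> \<circ> chart_inv \<psi>) (at (coords \<psi> p)) v)"
  by (rule fun_cong[OF frechet_derivative_at[OF has_derivative_change_chart[OF assms]], symmetric])

lemma tvec_of_same_chart:
  assumes "\<phi> \<in> charts_at A p"
  shows "tvec_of A \<phi> p v \<phi> = v"
proof -
  have A: "\<phi> \<in> A" "p \<in> chart_dom \<phi>"
    using assms by (auto simp: charts_at_def)
  have "((\<lambda>y. y) has_derivative (\<lambda>v. v)) (at (coords \<phi> p))"
    by (rule has_derivative_ident)
  then have "((coords \<phi> \<circ> chart_inv \<phi>) has_derivative (\<lambda>v. v)) (at (coords \<phi> p))"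
    by (rule has_derivative_transform_within_open[OF _ open_chart_range[OF A(1)]])
      (use A in \<open>auto simp: chart_inv_coords\<close>)
  then have "frechet_derivative (coords \<phi> \<circ> chart_inv \<phi>) (at (coords \<phi> p)) = (\<lambda>v. v)"
    by (rule frechet_derivative_at[symmetric])
  then show ?thesis
    using assms by (simp add: tvec_of_def)
qed

lemma tvec_of_in_tangent_space:
  assumes "\<phi> \<in> charts_at A p"
  shows "tvec_of A \<phi> p v \<in> tangent_space A p"
proof -
  have "tvec_of A \<phi> p v \<psi>
      = frechet_derivative (coords \<psi> \<circ> chart_inv \<eta>) (at (coords \<eta> p)) (tvec_of A \<phi> p v \<eta>)"
    if "\<eta> \<in> charts_at A p" "\<psi> \<in> charts_at A p" for \<eta> \<psi>
    using frechet_derivative_change_chart[OF that(1) assms transition_has_derivative[OF that]] that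
    by (simp only: tvec_of_def if_True)
  moreover have "tvec_of A \<phi> p v \<psi> = 0" if "\<psi> \<notin> charts_at A p" for \<psi>
    using that by (simp only: tvec_of_def if_False)
  ultimately show ?thesis
    unfolding tangent_space_def by blast
qed

lemma tangent_space_transition:
  assumes "X \<in> tangent_space A p" and "\<phi> \<in> charts_at A p" and "\<psi> \<in> charts_at A p"
  shows "X \<psi> = frechet_derivative (coords \<psi> \<circ> chart_inv \<phi>) (at (coords \<phi> p)) (X \<phi>)"
  using assms unfolding tangent_space_def by blast

lemma tvec_of_component:
  assumes "X \<in> tangent_space A p" and "\<phi> \<in> charts_at A p"
  shows "tvec_of A \<phi> p (X \<phi>) = X"
proof
  fix \<psi>
  show "tvec_of A \<phi> p (X \<phi>) \<psi> = X \<psi>"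
  proof (cases "\<psi> \<in> charts_at A p")
    case True
    then show ?thesis
      using tangent_space_transition[OF assms True] by (simp only: tvec_of_def if_True)
  next
    case False
    then have "X \<psi> = 0"
      using assms(1) unfolding tangent_space_def by blast
    with False show ?thesis
      by (simp only: tvec_of_def if_False)
  qed
qed

lemma tvec_of_combination:
  assumes "\<phi> \<in> charts_at A p"
  shows "tvec_of A \<phi> p (a *\<^sub>R v + b *\<^sub>R w) = (\<lambda>\<psi>. a *\<^sub>R tvec_of A \<phi> p v \<psi> + b *\<^sub>R tvec_of A \<phi> p w \<psi>)"
proof
  fix \<psi>
  show "tvec_of A \<phi> p (a *\<^sub>R v + b *\<^sub>R w) \<psi> = a *\<^sub>R tvec_of A \<phi> p v \<psi> + b *\<^sub>R tvec_of A \<phi> p w \<psi>"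
  proof (cases "\<psi> \<in> charts_at A p")
    case True
    have lin: "linear (frechet_derivative (coords \<psi> \<circ> chart_inv \<phi>) (at (coords \<phi> p)))"
      by (rule has_derivative_linear[OF transition_has_derivative[OF assms True]])
    show ?thesis
      using True by (simp add: tvec_of_def linear_add[OF lin] linear_scale[OF lin])
  qed (simp add: tvec_of_def)
qed

lemma differential_in_chart:
  assumes "differentiable_function A f" and "\<phi> \<in> charts_at A p" and "X \<in> tangent_space A p"
  shows "differential A f p X = frechet_derivative (f \<circ> chart_inv \<phi>) (at (coords \<phi> p)) (X \<phi>)"
proof -
  define \<psi> where "\<psi> = (SOME \<psi>. \<psi> \<in> charts_at A p)"
  have \<psi>: "\<psi> \<in> charts_at A p"
    unfolding \<psi>_def using assms(2) by (rule someI)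
  have \<phi>: "\<phi> \<in> A" "coords \<phi> p \<in> chart_range \<phi>"
    using assms(2) by (auto simp: charts_at_def)
  have "(f \<circ> chart_inv \<phi>) differentiable (at (coords \<phi> p) within chart_range \<phi>)"
    using assms(1) \<phi> unfolding differentiable_function_def differentiable_on_def by blast
  then have "(f \<circ> chart_inv \<phi>) differentiable (at (coords \<phi> p))"
    by (simp only: at_within_open[OF \<phi>(2) open_chart_range[OF \<phi>(1)]])
  then have "((f \<circ> chart_inv \<phi>) has_derivative
      frechet_derivative (f \<circ> chart_inv \<phi>) (at (coords \<phi> p))) (at (coords \<phi> p))"
    by (simp only: frechet_derivative_works)
  then have "frechet_derivative (f \<circ> chart_inv \<psi>) (at (coords \<psi> p)) (X \<psi>) =
      frechet_derivative (f \<circ> chart_inv \<phi>) (at (coords \<phi> p))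
        (frechet_derivative (coords \<phi> \<circ> chart_inv \<psi>) (at (coords \<psi> p)) (X \<psi>))"
    by (rule frechet_derivative_change_chart[OF assms(2) \<psi>])
  also have "frechet_derivative (coords \<phi> \<circ> chart_inv \<psi>) (at (coords \<psi> p)) (X \<psi>) = X \<phi>"
    by (rule tangent_space_transition[OF assms(3) \<psi> assms(2), symmetric])
  finally show ?thesis
    unfolding differential_def Let_def \<psi>_def .
qed

lemma eventually_in_open:
  assumes "continuous_map (top_of_set S) M \<gamma>" and "openin M V" and "u \<in> S" and "\<gamma> u \<in> V"
  shows "\<forall>\<^sub>F x in at u within S. \<gamma> x \<in> V"
proof -
  have "openin (top_of_set S) {x \<in> S. \<gamma> x \<in> V}"
    using openin_continuous_map_preimage[OF assms(1,2)] by simp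
  then obtain T where "open T" "{x \<in> S. \<gamma> x \<in> V} = S \<inter> T"
    by (auto simp: openin_open)
  then show ?thesis
    unfolding eventually_at_topological using assms(3,4) by blast
qed

text \<open>Smoothness of a curve is stated within the parameters that a chart covers. Since these form a
  relatively open set, derivatives within it are derivatives within the whole interval.\<close>

lemma at_within_preimage:
  assumes "continuous_map (top_of_set S) M \<gamma>" and "openin M V" and "u \<in> S" and "\<gamma> u \<in> V"
  shows "at u within {x \<in> S. \<gamma> x \<in> V} = at u within S"
proof -
  have "openin (top_of_set S) {x \<in> S. \<gamma> x \<in> V}"
    using openin_continuous_map_preimage[OF assms(1,2)] by simp
  then obtain T where T: "open T" "{x \<in> S. \<gamma> x \<in> V} = S \<inter> T"
    by (auto simp: openin_open)
  show ?thesis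
  proof (rule at_within_nhd)
    show "u \<in> T" using T assms(3,4) by blast
    show "open T" by (rule T)
    show "{x \<in> S. \<gamma> x \<in> V} \<inter> T - {u} = S \<inter> T - {u}" using T by blast
  qed
qed

lemma curve_chain_rule:
  assumes "continuous_map (top_of_set S) M \<gamma>" and "u \<in> S" and "\<phi> \<in> charts_at A (\<gamma> u)"
    and "((coords \<phi> \<circ> \<gamma>) has_vector_derivative v) (at u within S)"
    and "((k \<circ> chart_inv \<phi>) has_derivative D) (at (coords \<phi> (\<gamma> u)))"
  shows "((k \<circ> \<gamma>) has_vector_derivative D v) (at u within S)"
proof -
  have \<phi>: "\<phi> \<in> A" "\<gamma> u \<in> chart_dom \<phi>"
    using assms(3) by (auto simp: charts_at_def)
  have *: "((\<lambda>x. (k \<circ> chart_inv \<phi>) ((coords \<phi> \<circ> \<gamma>) x)) has_derivative (\<lambda>h. D (h *\<^sub>R v))) (at u within S)"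
    by (rule has_derivative_compose[OF assms(4)[unfolded has_vector_derivative_def]])
      (use assms(5) in \<open>simp add: o_def\<close>)
  have "((k \<circ> \<gamma>) has_derivative (\<lambda>h. D (h *\<^sub>R v))) (at u within S)"
  proof (rule has_derivative_transform_eventually[OF *])
    show "\<forall>\<^sub>F x in at u within S. (k \<circ> chart_inv \<phi>) ((coords \<phi> \<circ> \<gamma>) x) = (k \<circ> \<gamma>) x"
      using eventually_in_open[OF assms(1) openin_chart_dom[OF \<phi>(1)] assms(2) \<phi>(2)]
      by eventually_elim (simp add: chart_inv_coords \<phi>(1))
  qed (simp_all add: \<phi> assms(2) chart_inv_coords)
  then show ?thesis
    by (simp add: has_vector_derivative_def linear_scale[OF has_derivative_linear[OF assms(5)]])
qed

text \<open>It suffices to differentiate a curve in a single chart; the other components of its velocity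
  follow by the chain rule.\<close>

lemma velocity_eq_tvec_of:
  assumes "a < b" and "continuous_map (top_of_set {a..b}) M \<gamma>" and "u \<in> {a..b}"
    and "\<phi> \<in> charts_at A (\<gamma> u)"
    and "((coords \<phi> \<circ> \<gamma>) has_vector_derivative v) (at u within {a..b})"
  shows "velocity A a b \<gamma> u = tvec_of A \<phi> (\<gamma> u) v"
proof
  fix \<psi>
  show "velocity A a b \<gamma> u \<psi> = tvec_of A \<phi> (\<gamma> u) v \<psi>"
  proof (cases "\<psi> \<in> charts_at A (\<gamma> u)")
    case True
    have "((coords \<psi> \<circ> \<gamma>) has_vector_derivative tvec_of A \<phi> (\<gamma> u) v \<psi>) (at u within cbox a b)"
      using curve_chain_rule[OF assms(2-5) transition_has_derivative[OF assms(4) True]] True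
      by (simp add: tvec_of_def)
    from vector_derivative_within_cbox[OF assms(1) _ this] show ?thesis
      using True assms(3) by (simp add: velocity_def)
  qed (simp add: velocity_def tvec_of_def)
qed

lemma smooth_curve_continuous:
  "smooth_curve M A a b \<gamma> \<Longrightarrow> continuous_map (top_of_set {a..b}) M \<gamma>"
  by (simp add: smooth_curve_def)

lemma smooth_curve_in_chart:
  assumes "smooth_curve M A a b \<gamma>" and "u \<in> {a..b}" and "\<phi> \<in> charts_at A (\<gamma> u)"
  obtains c where "\<And>x. x \<in> {a..b} \<Longrightarrow> \<gamma> x \<in> chart_dom \<phi> \<Longrightarrow>
      ((coords \<phi> \<circ> \<gamma>) has_vector_derivative c x) (at x within {a..b})"
    and "(c \<longlongrightarrow> c u) (at u within {a..b})"
proof -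
  define S where "S = {x \<in> {a..b}. \<gamma> x \<in> chart_dom \<phi>}"
  define c where "c x = frechet_derivative (coords \<phi> \<circ> \<gamma>) (at x within S) 1" for x
  have \<phi>: "\<phi> \<in> A" "u \<in> S"
    using assms(2,3) by (auto simp: charts_at_def S_def)
  have smooth: "smooth_on S (coords \<phi> \<circ> \<gamma>)"
    using assms(1) \<phi>(1) unfolding smooth_curve_def S_def by blast
  have at: "at x within S = at x within {a..b}" if "x \<in> S" for x
    unfolding S_def
    by (rule at_within_preimage[OF smooth_curve_continuous[OF assms(1)] openin_chart_dom[OF \<phi>(1)]])
      (use that in \<open>simp_all add: S_def\<close>)
  show ?thesis
  proof
    fix x assume "x \<in> {a..b}" "\<gamma> x \<in> chart_dom \<phi>"
    then have x: "x \<in> S" by (simp add: S_def)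
    have D: "((coords \<phi> \<circ> \<gamma>) has_derivative
        frechet_derivative (coords \<phi> \<circ> \<gamma>) (at x within S)) (at x within S)"
      by (rule smooth_on_has_derivative[OF smooth x])
    have "frechet_derivative (coords \<phi> \<circ> \<gamma>) (at x within S) = (\<lambda>h. h *\<^sub>R c x)"
    proof
      show "frechet_derivative (coords \<phi> \<circ> \<gamma>) (at x within S) h = h *\<^sub>R c x" for h
        using linear_scale[OF has_derivative_linear[OF D], of h 1] by (simp add: c_def)
    qed
    with D show "((coords \<phi> \<circ> \<gamma>) has_vector_derivative c x) (at x within {a..b})"
      by (simp only: has_vector_derivative_def at[OF x])
  next
    have "continuous_on S c"
      unfolding c_def by (rule smooth_on_continuous_frechet_derivative[OF smooth])
    then have "(c \<longlongrightarrow> c u) (at u within S)"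
      using \<phi>(2) unfolding continuous_on_def by blast
    then show "(c \<longlongrightarrow> c u) (at u within {a..b})"
      by (simp only: at[OF \<phi>(2)])
  qed
qed

lemma line_in_chart:
  fixes y w :: 'e
  assumes "\<phi> \<in> A" and "a < b" and "\<And>u. u \<in> {a..b} \<Longrightarrow> y + u *\<^sub>R w \<in> chart_range \<phi>"
  defines "\<beta> \<equiv> \<lambda>u. chart_inv \<phi> (y + u *\<^sub>R w)"
  shows smooth_curve_line: "smooth_curve M A a b \<beta>"
    and velocity_line: "u \<in> {a..b} \<Longrightarrow> velocity A a b \<beta> u = tvec_of A \<phi> (\<beta> u) w"
proof -
  have "continuous_on {a..b} (\<lambda>u. y + u *\<^sub>R w)"
    by (intro continuous_intros)
  then have "continuous_map (top_of_set {a..b}) (top_of_set (chart_range \<phi>)) (\<lambda>u. y + u *\<^sub>R w)"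
    using assms(3) by (auto simp: continuous_map_in_subtopology)
  from continuous_map_compose[OF this continuous_chart_inv[OF assms(1)]]
  have cont: "continuous_map (top_of_set {a..b}) M \<beta>"
    by (simp add: \<beta>_def o_def)
  have "smooth_on {u \<in> {a..b}. \<beta> u \<in> chart_dom \<psi>} (coords \<psi> \<circ> \<beta>)" if \<psi>: "\<psi> \<in> A" for \<psi>
  proof -
    let ?S = "{u \<in> {a..b}. \<beta> u \<in> chart_dom \<psi>}"
    let ?U = "coords \<phi> ` (chart_dom \<phi> \<inter> chart_dom \<psi>)"
    have "y + u *\<^sub>R w \<in> ?U" if "u \<in> ?S" for u
    proof
      show "y + u *\<^sub>R w = coords \<phi> (\<beta> u)"
        unfolding \<beta>_def using that assms(3) by (intro coords_chart_inv[symmetric]) auto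
      show "\<beta> u \<in> chart_dom \<phi> \<inter> chart_dom \<psi>"
        unfolding \<beta>_def using that assms(3) chart_inv_in_dom by (auto simp: \<beta>_def)
    qed
    moreover have "at u within ?S \<noteq> bot" if "u \<in> ?S" for u
      using that at_within_preimage[OF cont openin_chart_dom[OF \<psi>], of u] assms(2)
      by (simp add: trivial_limit_within islimpt_Icc)
    moreover have "Ck_on k ?U (coords \<psi> \<circ> chart_inv \<phi>)" for k
      using transition_smooth[OF assms(1) \<psi>] unfolding smooth_on_def by blast
    ultimately have "Ck_on k ?S (\<lambda>u. (coords \<psi> \<circ> chart_inv \<phi>) (y + u *\<^sub>R w))" for k
      by (rule Ck_on_line[OF open_overlap[OF assms(1) \<psi>]])
    then show ?thesis
      by (simp add: smooth_on_def \<beta>_def o_def)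
  qed
  then show "smooth_curve M A a b \<beta>"
    using assms(2) cont by (simp add: smooth_curve_def)
  assume u: "u \<in> {a..b}"
  have "((\<lambda>u. y + u *\<^sub>R w) has_vector_derivative w) (at u within {a..b})"
    by (auto intro!: derivative_eq_intros)
  then have "((coords \<phi> \<circ> \<beta>) has_vector_derivative w) (at u within {a..b})"
    by (rule has_vector_derivative_transform[OF u, rotated])
      (simp add: \<beta>_def coords_chart_inv assms(3))
  moreover have "\<phi> \<in> charts_at A (\<beta> u)"
    using assms(1,3) u chart_inv_in_dom by (auto simp: charts_at_def \<beta>_def)
  ultimately show "velocity A a b \<beta> u = tvec_of A \<phi> (\<beta> u) w"
    using velocity_eq_tvec_of[OF assms(2) cont u] by blast
qed

end


section \<open>The metric and the gradient in a chart\<close>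

locale lorentzian =
  fixes n :: nat and M :: "'a topology" and A :: "('a, 'e::euclidean_space) chart set"
    and g :: "('a, 'e) metric"
  assumes lorentzian_manifold: "lorentzian_manifold n M A g"

sublocale lorentzian \<subseteq> manifold M A
  using lorentzian_manifold by (simp add: manifold_def lorentzian_manifold_def)

context lorentzian
begin

definition chart_form :: "('a, 'e) chart \<Rightarrow> 'a \<Rightarrow> 'e \<Rightarrow> 'e \<Rightarrow> real" where
  "chart_form \<phi> p v w = g p (tvec_of A \<phi> p v) (tvec_of A \<phi> p w)"

lemma charts_at_imp_topspace:
  assumes "\<phi> \<in> charts_at A p"
  shows "p \<in> topspace M"
  using assms openin_subset[OF openin_chart_dom] unfolding charts_at_def by blast

lemma chart_form_component:
  assumes "X \<in> tangent_space A p" and "Y \<in> tangent_space A p" and "\<phi> \<in> charts_at A p"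
  shows "chart_form \<phi> p (X \<phi>) (Y \<phi>) = g p X Y"
  by (simp only: chart_form_def tvec_of_component[OF assms(1,3)] tvec_of_component[OF assms(2,3)])

lemma chart_form_sym:
  assumes "\<phi> \<in> charts_at A p"
  shows "chart_form \<phi> p v w = chart_form \<phi> p w v"
  using lorentzian_manifold charts_at_imp_topspace[OF assms] tvec_of_in_tangent_space[OF assms]
  unfolding lorentzian_manifold_def chart_form_def by blast

lemma chart_form_combination:
  assumes "\<phi> \<in> charts_at A p"
  shows "chart_form \<phi> p (a *\<^sub>R v + b *\<^sub>R w) z = a * chart_form \<phi> p v z + b * chart_form \<phi> p w z"
  using lorentzian_manifold charts_at_imp_topspace[OF assms] tvec_of_in_tangent_space[OF assms]
  unfolding lorentzian_manifold_def chart_form_def tvec_of_combination[OF assms] by blast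

lemma bilinear_chart_form:
  assumes "\<phi> \<in> charts_at A p"
  shows "bilinear (chart_form \<phi> p)"
proof -
  have left: "linear (\<lambda>v. chart_form \<phi> p v z)" for z
  proof (rule linearI)
    show "chart_form \<phi> p (v + w) z = chart_form \<phi> p v z + chart_form \<phi> p w z" for v w
      using chart_form_combination[OF assms, of 1 v 1 w z] by simp
    show "chart_form \<phi> p (r *\<^sub>R v) z = r *\<^sub>R chart_form \<phi> p v z" for r v
      using chart_form_combination[OF assms, of r v 0 v z] by simp
  qed
  moreover have "linear (\<lambda>w. chart_form \<phi> p z w)" for z
    using left[of z] by (subst chart_form_sym[OF assms])
  ultimately show ?thesis
    by (simp add: bilinear_def)
qed

text \<open>In a chart each tangent space becomes the coordinate space with a Lorentzian scalar product,
  since tangent vectors correspond linearly to their coordinate vectors.\<close>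

lemma lorentz_form_chart_form:
  assumes "\<phi> \<in> charts_at A p"
  obtains e where "lorentz_form (chart_form \<phi> p) n e"
proof -
  obtain E where E: "\<forall>i\<le>n. E i \<in> tangent_space A p"
    "\<forall>i\<le>n. \<forall>j\<le>n. g p (E i) (E j) = (if i \<noteq> j then 0 else if i = 0 then -1 else 1)"
    using lorentzian_manifold charts_at_imp_topspace[OF assms]
    unfolding lorentzian_manifold_def by blast
  have "lorentz_form (chart_form \<phi> p) n (\<lambda>i. E i \<phi>)"
  proof
    show "DIM('e) = n + 1"
      using lorentzian_manifold by (simp add: lorentzian_manifold_def)
    show "bilinear (chart_form \<phi> p)"
      by (rule bilinear_chart_form[OF assms])
    show "chart_form \<phi> p v w = chart_form \<phi> p w v" for v w
      by (rule chart_form_sym[OF assms])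
    show "chart_form \<phi> p (E i \<phi>) (E j \<phi>) = (if i \<noteq> j then 0 else if i = 0 then -1 else 1)"
      if "i \<le> n" "j \<le> n" for i j
      using E that by (simp only: chart_form_component[OF _ _ assms])
  qed
  then show ?thesis
    by (rule that)
qed

text \<open>The components of the metric are continuous, and the metric is bilinear, so it is jointly
  continuous in the base point and both vectors.\<close>

lemma tendsto_chart_form:
  assumes "\<phi> \<in> A" and "y \<in> chart_range \<phi>"
    and "(Y \<longlongrightarrow> y) G" and "(V \<longlongrightarrow> v) G" and "(W \<longlongrightarrow> w) G"
  shows "((\<lambda>k. chart_form \<phi> (chart_inv \<phi> (Y k)) (V k) (W k)) \<longlongrightarrow> chart_form \<phi> (chart_inv \<phi> y) v w) G"
proof -
  let ?B = "\<lambda>x. chart_form \<phi> (chart_inv \<phi> x)"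
  have exp: "?B x v w = (\<Sum>i\<in>Basis. \<Sum>j\<in>Basis. (v \<bullet> i) * ((w \<bullet> j) * ?B x i j))"
    if "x \<in> chart_range \<phi>" for x v w
  proof -
    have bil: "bilinear (?B x)"
      using that assms(1) chart_inv_in_dom by (intro bilinear_chart_form) (auto simp: charts_at_def)
    then have l: "linear (\<lambda>v. ?B x v z)" and r: "linear (?B x z)" for z
      by (simp_all add: bilinear_def)
    have "?B x v w = ?B x (\<Sum>i\<in>Basis. (v \<bullet> i) *\<^sub>R i) (\<Sum>j\<in>Basis. (w \<bullet> j) *\<^sub>R j)"
      by (simp only: euclidean_representation)
    also have "\<dots> = (\<Sum>i\<in>Basis. (v \<bullet> i) * ?B x i (\<Sum>j\<in>Basis. (w \<bullet> j) *\<^sub>R j))"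
      by (simp only: linear_sum[OF l] linear_scale[OF l] real_scaleR_def)
    also have "\<dots> = (\<Sum>i\<in>Basis. \<Sum>j\<in>Basis. (v \<bullet> i) * ((w \<bullet> j) * ?B x i j))"
      by (simp only: linear_sum[OF r] linear_scale[OF r] real_scaleR_def sum_distrib_left)
    finally show ?thesis .
  qed
  have "((\<lambda>k. ?B (Y k) i j) \<longlongrightarrow> ?B y i j) G" for i j
  proof -
    have "smooth_on (chart_range \<phi>) (\<lambda>x. ?B x i j)"
      using lorentzian_manifold assms(1)
      unfolding lorentzian_manifold_def chart_form_def Let_def by blast
    then have "continuous_on (chart_range \<phi>) (\<lambda>x. ?B x i j)"
      by (rule smooth_on_continuous_on)
    then have "isCont (\<lambda>x. ?B x i j) y"
      unfolding continuous_on_eq_continuous_at[OF open_chart_range[OF assms(1)]]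
      using assms(2) by blast
    then show ?thesis
      using assms(3) by (rule isCont_tendsto_compose)
  qed
  then have "((\<lambda>k. \<Sum>i\<in>Basis. \<Sum>j\<in>Basis. (V k \<bullet> i) * ((W k \<bullet> j) * ?B (Y k) i j))
      \<longlongrightarrow> (\<Sum>i\<in>Basis. \<Sum>j\<in>Basis. (v \<bullet> i) * ((w \<bullet> j) * ?B y i j))) G"
    by (intro tendsto_intros assms(4,5))
  moreover have "\<forall>\<^sub>F k in G. Y k \<in> chart_range \<phi>"
    using topological_tendstoD[OF assms(3) open_chart_range[OF assms(1)] assms(2)] .
  then have "\<forall>\<^sub>F k in G. (\<Sum>i\<in>Basis. \<Sum>j\<in>Basis. (V k \<bullet> i) * ((W k \<bullet> j) * ?B (Y k) i j))
      = ?B (Y k) (V k) (W k)"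
    by (rule eventually_mono) (rule exp[symmetric])
  ultimately have "((\<lambda>k. ?B (Y k) (V k) (W k))
      \<longlongrightarrow> (\<Sum>i\<in>Basis. \<Sum>j\<in>Basis. (v \<bullet> i) * ((w \<bullet> j) * ?B y i j))) G"
    by (rule Lim_transform_eventually)
  then show ?thesis
    unfolding exp[OF assms(2), of v w] .
qed

text \<open>Nondegeneracy of the metric makes the definite description in the definition of the gradient
  denote.\<close>

lemma gradient:
  assumes "differentiable_function A f" and "p \<in> topspace M"
  shows gradient_in_tangent_space: "gradient A g f p \<in> tangent_space A p"
    and metric_gradient: "Y \<in> tangent_space A p \<Longrightarrow> g p (gradient A g f p) Y = differential A f p Y"
proof -
  obtain \<phi> where \<phi>: "\<phi> \<in> charts_at A p"
    using smooth_manifold assms(2) unfolding smooth_manifold_def charts_at_def by blast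
  then obtain e where "lorentz_form (chart_form \<phi> p) n e"
    by (rule lorentz_form_chart_form)
  then interpret lorentz_form "chart_form \<phi> p" n e .
  let ?l = "frechet_derivative (f \<circ> chart_inv \<phi>) (at (coords \<phi> p))"
  have \<phi>': "\<phi> \<in> A" "coords \<phi> p \<in> chart_range \<phi>"
    using \<phi> by (auto simp: charts_at_def)
  have "(f \<circ> chart_inv \<phi>) differentiable (at (coords \<phi> p) within chart_range \<phi>)"
    using assms(1) \<phi>' unfolding differentiable_function_def differentiable_on_def by blast
  then have "linear ?l"
    unfolding at_within_open[OF \<phi>'(2) open_chart_range[OF \<phi>'(1)]]
    by (rule linear_frechet_derivative)
  then obtain v where v: "\<And>w. chart_form \<phi> p v w = ?l w"
    and v_unique: "\<And>v'. \<forall>w. chart_form \<phi> p v' w = ?l w \<Longrightarrow> v' = v"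
    using representation by blast
  have "\<exists>!X. X \<in> tangent_space A p \<and> (\<forall>Y\<in>tangent_space A p. g p X Y = differential A f p Y)"
  proof (rule ex1I)
    have "g p (tvec_of A \<phi> p v) Y = differential A f p Y" if Y: "Y \<in> tangent_space A p" for Y
      using v[of "Y \<phi>"] unfolding chart_form_def tvec_of_component[OF Y \<phi>]
        differential_in_chart[OF assms(1) \<phi> Y] .
    then show "tvec_of A \<phi> p v \<in> tangent_space A p
        \<and> (\<forall>Y\<in>tangent_space A p. g p (tvec_of A \<phi> p v) Y = differential A f p Y)"
      using tvec_of_in_tangent_space[OF \<phi>] by blast
  next
    fix X assume X: "X \<in> tangent_space A p \<and> (\<forall>Y\<in>tangent_space A p. g p X Y = differential A f p Y)"
    have "chart_form \<phi> p (X \<phi>) w = ?l w" for w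
    proof -
      have w: "tvec_of A \<phi> p w \<in> tangent_space A p"
        by (rule tvec_of_in_tangent_space[OF \<phi>])
      have "chart_form \<phi> p (X \<phi>) w = g p X (tvec_of A \<phi> p w)"
        using X by (simp only: chart_form_def tvec_of_component[OF _ \<phi>])
      also have "\<dots> = differential A f p (tvec_of A \<phi> p w)"
        using X w by blast
      also have "\<dots> = ?l w"
        by (simp only: differential_in_chart[OF assms(1) \<phi> w] tvec_of_same_chart[OF \<phi>])
      finally show ?thesis .
    qed
    then have "X \<phi> = v"
      using v_unique by blast
    moreover have "tvec_of A \<phi> p (X \<phi>) = X"
      using X by (intro tvec_of_component[OF _ \<phi>]) blast
    ultimately show "X = tvec_of A \<phi> p v"
      by simp
  qed
  from theI'[OF this]
  show "gradient A g f p \<in> tangent_space A p"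
    and "Y \<in> tangent_space A p \<Longrightarrow> g p (gradient A g f p) Y = differential A f p Y"
    unfolding gradient_def by blast+
qed

end


section \<open>Causal directions near a level set\<close>

locale temporal_spacetime =
  fixes n :: nat and M :: "'a topology" and A :: "('a, 'e::euclidean_space) chart set"
    and g :: "('a, 'e) metric" and \<theta> :: "'a \<Rightarrow> ('a, 'e) tvec" and f :: "'a \<Rightarrow> real"
  assumes spacetime: "spacetime n M A g \<theta>"
    and smooth: "smooth_function A f"
    and temporal: "temporal_function M A g \<theta> f"

sublocale temporal_spacetime \<subseteq> lorentzian n M A g
  using spacetime by (simp add: lorentzian_def spacetime_def)

context temporal_spacetime
begin

lemma differentiable: "differentiable_function A f"
  using temporal by (simp add: temporal_function_def)

abbreviation chart_differential :: "('a, 'e) chart \<Rightarrow> 'e \<Rightarrow> 'e \<Rightarrow> real" where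
  "chart_differential \<phi> y \<equiv> frechet_derivative (f \<circ> chart_inv \<phi>) (at y)"

lemma has_derivative_chart_differential:
  assumes "\<phi> \<in> A" and "y \<in> chart_range \<phi>"
  shows "((f \<circ> chart_inv \<phi>) has_derivative chart_differential \<phi> y) (at y)"
proof -
  have "smooth_on (chart_range \<phi>) (f \<circ> chart_inv \<phi>)"
    using smooth assms(1) unfolding smooth_function_def by blast
  from smooth_on_has_derivative[OF this assms(2)] show ?thesis
    unfolding at_within_open[OF assms(2) open_chart_range[OF assms(1)]] .
qed

lemma tendsto_chart_differential:
  assumes "\<phi> \<in> A" and "y \<in> chart_range \<phi>" and "(Y \<longlongrightarrow> y) G" and "(V \<longlongrightarrow> v) G"
  shows "((\<lambda>k. chart_differential \<phi> (Y k) (V k)) \<longlongrightarrow> chart_differential \<phi> y v) G"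
  using smooth assms(1) unfolding smooth_function_def
  by (intro tendsto_frechet_derivative[OF open_chart_range[OF assms(1)] _ assms(2-4)]) blast

text \<open>The sign makes this vector future-directed; \<open>f\<close> increases in its direction.\<close>

definition up :: "('a, 'e) chart \<Rightarrow> 'a \<Rightarrow> 'e" where
  "up \<phi> p = - gradient A g f p \<phi>"

lemma chart_form_up:
  assumes "\<phi> \<in> charts_at A p"
  shows "chart_form \<phi> p v (up \<phi> p) = - chart_differential \<phi> (coords \<phi> p) v"
proof -
  note p = charts_at_imp_topspace[OF assms]
  note grad = gradient_in_tangent_space[OF differentiable p]
  note v = tvec_of_in_tangent_space[OF assms, of v]
  have "chart_form \<phi> p (gradient A g f p \<phi>) v = g p (gradient A g f p) (tvec_of A \<phi> p v)"
    by (simp only: chart_form_def tvec_of_component[OF grad assms])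
  also have "\<dots> = chart_differential \<phi> (coords \<phi> p) v"
    by (simp only: metric_gradient[OF differentiable p v]
        differential_in_chart[OF differentiable assms v] tvec_of_same_chart[OF assms])
  finally show ?thesis
    unfolding up_def bilinear_rneg[OF bilinear_chart_form[OF assms]]
    by (simp add: chart_form_sym[OF assms])
qed

lemma chart_form_up_up:
  assumes "\<phi> \<in> charts_at A p"
  shows "chart_form \<phi> p (up \<phi> p) (up \<phi> p) = g p (gradient A g f p) (gradient A g f p)"
  using chart_form_component[OF gradient_in_tangent_space gradient_in_tangent_space assms,
      OF differentiable _ differentiable] charts_at_imp_topspace[OF assms]
  by (simp add: up_def bilinear_rneg[OF bilinear_chart_form[OF assms]]
      bilinear_lneg[OF bilinear_chart_form[OF assms]])

lemma timelike_up:
  assumes "\<phi> \<in> charts_at A p"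
  shows "chart_form \<phi> p (up \<phi> p) (up \<phi> p) < 0"
  using temporal charts_at_imp_topspace[OF assms]
  by (simp add: chart_form_up_up[OF assms] temporal_function_def timelike_def)

lemma orientation_in_tangent_space:
  assumes "p \<in> topspace M"
  shows "\<theta> p \<in> tangent_space A p"
  using spacetime assms by (simp add: spacetime_def time_orientation_def timelike_def)

lemma timelike_orientation:
  assumes "\<phi> \<in> charts_at A p"
  shows "chart_form \<phi> p (\<theta> p \<phi>) (\<theta> p \<phi>) < 0"
proof -
  note p = charts_at_imp_topspace[OF assms]
  have "g p (\<theta> p) (\<theta> p) < 0"
    using spacetime p by (simp add: spacetime_def time_orientation_def timelike_def)
  then show ?thesis
    using orientation_in_tangent_space[OF p] by (simp only: chart_form_component[OF _ _ assms])
qed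

lemma future_directed_up:
  assumes "\<phi> \<in> charts_at A p"
  shows "chart_form \<phi> p (up \<phi> p) (\<theta> p \<phi>) < 0"
proof -
  note p = charts_at_imp_topspace[OF assms]
  have "g p (gradient A g f p) (\<theta> p) > 0"
    using temporal p by (simp add: temporal_function_def past_directed_def)
  then show ?thesis
    unfolding up_def bilinear_lneg[OF bilinear_chart_form[OF assms]]
      chart_form_component[OF gradient_in_tangent_space[OF differentiable p]
        orientation_in_tangent_space[OF p] assms] by simp
qed

text \<open>A vector annihilated by \<open>df\<close> is orthogonal to the timelike gradient.\<close>

lemma level_tangent_nonneg:
  assumes "\<phi> \<in> charts_at A p" and "chart_differential \<phi> (coords \<phi> p) w = 0"
  shows "0 \<le> chart_form \<phi> p w w"
proof -
  obtain e where "lorentz_form (chart_form \<phi> p) n e"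
    using assms(1) by (rule lorentz_form_chart_form)
  then interpret lorentz_form "chart_form \<phi> p" n e .
  show ?thesis
    using orthogonal_to_timelike[OF timelike_up[OF assms(1)]] chart_form_up[OF assms(1)] assms(2)
    by simp
qed

text \<open>As \<open>w\<close> and the normal vector \<open>N\<close> are orthogonal, \<open>w + N\<close> and \<open>w - N\<close> have the same scalar
  square \<open>g(w, w) - (\<mu> C)\<^sup>2\<close>, which is negative when \<open>\<mu> C\<close> exceeds the length of \<open>w\<close>. The time
  orientation is inherited from \<open>N\<close> and \<open>- N\<close>.\<close>

lemma tangent_plus_normal:
  assumes "\<phi> \<in> charts_at A p" and "chart_differential \<phi> (coords \<phi> p) w = 0"
    and "0 < \<mu>" and "sqrt (chart_form \<phi> p w w) < \<mu> * C"
    and "g p (gradient A g f p) (gradient A g f p) = - (C ^ 2)"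
  defines "N \<equiv> \<mu> *\<^sub>R up \<phi> p"
  shows timelike_up_leg: "chart_form \<phi> p (w + N) (w + N) < 0"
    and timelike_down_leg: "chart_form \<phi> p (w - N) (w - N) < 0"
    and future_up_leg: "chart_form \<phi> p (w + N) (\<theta> p \<phi>) < 0"
    and past_down_leg: "chart_form \<phi> p (w - N) (\<theta> p \<phi>) > 0"
    and slope_up_leg: "chart_differential \<phi> (coords \<phi> p) (w + N) = \<mu> * C ^ 2"
proof -
  obtain e where "lorentz_form (chart_form \<phi> p) n e"
    using assms(1) by (rule lorentz_form_chart_form)
  then interpret lorentz_form "chart_form \<phi> p" n e .
  have NN: "chart_form \<phi> p N N = - ((\<mu> * C)\<^sup>2)"
    using assms(5) chart_form_up_up[OF assms(1)]
    by (simp add: N_def B_simps power2_eq_square)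
  have wN: "chart_form \<phi> p w N = 0"
    using chart_form_up[OF assms(1), of w] assms(2) by (simp add: N_def B_simps)
  have N: "chart_form \<phi> p N N < 0"
    using timelike_up[OF assms(1)] assms(3) by (simp add: N_def B_simps mult_pos_neg)
  have ww: "chart_form \<phi> p w w < (\<mu> * C)\<^sup>2"
    using power_strict_mono[OF assms(4), of 2] level_tangent_nonneg[OF assms(1,2)] by simp
  show up: "chart_form \<phi> p (w + N) (w + N) < 0" and down: "chart_form \<phi> p (w - N) (w - N) < 0"
    using ww NN wN sym[of N w] by (simp_all add: B_simps)
  note T = timelike_orientation[OF assms(1)]
  have NT: "chart_form \<phi> p N (\<theta> p \<phi>) < 0"
    using future_directed_up[OF assms(1)] assms(3) by (simp add: N_def B_simps mult_pos_neg)
  show "chart_form \<phi> p (w + N) (\<theta> p \<phi>) < 0"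
    by (rule same_time_cone[OF N T NT wN up])
  have "chart_form \<phi> p (- w + N) (\<theta> p \<phi>) < 0"
    by (rule same_time_cone[OF N T NT]) (use wN down sym[of N w] in \<open>simp_all add: B_simps\<close>)
  then show "chart_form \<phi> p (w - N) (\<theta> p \<phi>) > 0"
    by (simp add: B_simps)
  have "chart_differential \<phi> (coords \<phi> p) (w + N) = - chart_form \<phi> p (w + N) (up \<phi> p)"
    using chart_form_up[OF assms(1)] by simp
  also have "\<dots> = \<mu> * C ^ 2"
    using wN assms(3,5) chart_form_up_up[OF assms(1)] by (simp add: N_def B_simps)
  finally show "chart_differential \<phi> (coords \<phi> p) (w + N) = \<mu> * C ^ 2" .
qed

text \<open>The conditions on the two legs are strict inequalities between continuous functions, so they
  persist for nearby base points and nearby directions.\<close>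

lemma legs_stable:
  assumes "\<phi> \<in> charts_at A p" and "chart_differential \<phi> (coords \<phi> p) w = 0"
    and "0 < \<mu>" and "sqrt (chart_form \<phi> p w w) < \<mu> * C" and "0 < \<eta>" and "0 < C"
    and "g p (gradient A g f p) (gradient A g f p) = - (C ^ 2)"
  defines "N \<equiv> \<mu> *\<^sub>R up \<phi> p"
  obtains r where "0 < r" and "ball (coords \<phi> p) r \<subseteq> chart_range \<phi>"
    and "\<And>y v q. \<lbrakk>y \<in> ball (coords \<phi> p) r; v \<in> ball w r; q = chart_inv \<phi> y\<rbrakk> \<Longrightarrow>
      chart_form \<phi> q (v + N) (v + N) < 0 \<and> chart_form \<phi> q (v - N) (v - N) < 0 \<and>
      chart_form \<phi> q (v + N) (\<theta> q \<phi>) < 0 \<and> 0 < chart_form \<phi> q (v - N) (\<theta> q \<phi>) \<and>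
      0 < chart_differential \<phi> y (v + N) \<and> chart_differential \<phi> y (v + N) < \<mu> * C ^ 2 + \<eta>"
proof -
  let ?y = "coords \<phi> p" and ?q = "\<lambda>z. chart_inv \<phi> (fst z)"
  let ?G = "nhds ?y \<times>\<^sub>F nhds w"
  have \<phi>: "\<phi> \<in> A" "p \<in> chart_dom \<phi>" "?y \<in> chart_range \<phi>"
    using assms(1) by (auto simp: charts_at_def)
  note p = chart_inv_coords[OF \<phi>(1,2)]
  have fst: "(fst \<longlongrightarrow> ?y) ?G" and snd: "(snd \<longlongrightarrow> w) ?G"
    by (rule filterlim_fst filterlim_snd)+
  have plus: "((\<lambda>z. snd z + N) \<longlongrightarrow> w + N) ?G" and minus: "((\<lambda>z. snd z - N) \<longlongrightarrow> w - N) ?G"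
    by (intro tendsto_intros snd)+
  have "continuous_on (chart_range \<phi>) (\<lambda>x. \<theta> (chart_inv \<phi> x) \<phi>)"
    using spacetime \<phi>(1)
    by (intro smooth_on_continuous_on)
      (simp add: spacetime_def time_orientation_def smooth_vector_field_def)
  then have "isCont (\<lambda>x. \<theta> (chart_inv \<phi> x) \<phi>) ?y"
    unfolding continuous_on_eq_continuous_at[OF open_chart_range[OF \<phi>(1)]] using \<phi>(3) by blast
  from isCont_tendsto_compose[OF this fst]
  have T: "((\<lambda>z. \<theta> (?q z) \<phi>) \<longlongrightarrow> \<theta> p \<phi>) ?G"
    by (simp only: p)
  note form = tendsto_chart_form[OF \<phi>(1,3) fst, unfolded p]
  note legs = tangent_plus_normal[OF assms(1-4,7), folded N_def]
  have slope: "((\<lambda>z. chart_differential \<phi> (fst z) (snd z + N)) \<longlongrightarrow> \<mu> * C ^ 2) ?G"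
    using tendsto_chart_differential[OF \<phi>(1,3) fst plus] by (simp only: legs(5))
  have "\<forall>\<^sub>F z in ?G. fst z \<in> chart_range \<phi> \<and>
      chart_form \<phi> (?q z) (snd z + N) (snd z + N) < 0 \<and>
      chart_form \<phi> (?q z) (snd z - N) (snd z - N) < 0 \<and>
      chart_form \<phi> (?q z) (snd z + N) (\<theta> (?q z) \<phi>) < 0 \<and>
      0 < chart_form \<phi> (?q z) (snd z - N) (\<theta> (?q z) \<phi>) \<and>
      0 < chart_differential \<phi> (fst z) (snd z + N) \<and>
      chart_differential \<phi> (fst z) (snd z + N) < \<mu> * C ^ 2 + \<eta>"
    using topological_tendstoD[OF fst open_chart_range[OF \<phi>(1)] \<phi>(3)]
      order_tendstoD(2)[OF form[OF plus plus] legs(1)]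
      order_tendstoD(2)[OF form[OF minus minus] legs(2)]
      order_tendstoD(2)[OF form[OF plus T] legs(3)]
      order_tendstoD(1)[OF form[OF minus T] legs(4)]
      order_tendstoD(1)[OF slope, of 0] order_tendstoD(2)[OF slope, of "\<mu> * C ^ 2 + \<eta>"]
      assms(3,5,6)
    by (simp add: eventually_conj_iff)
  then obtain P Q where PQ: "eventually P (nhds ?y)" "eventually Q (nhds w)"
    and *: "\<And>y v. P y \<Longrightarrow> Q v \<Longrightarrow> y \<in> chart_range \<phi> \<and>
      chart_form \<phi> (chart_inv \<phi> y) (v + N) (v + N) < 0 \<and>
      chart_form \<phi> (chart_inv \<phi> y) (v - N) (v - N) < 0 \<and>
      chart_form \<phi> (chart_inv \<phi> y) (v + N) (\<theta> (chart_inv \<phi> y) \<phi>) < 0 \<and>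
      0 < chart_form \<phi> (chart_inv \<phi> y) (v - N) (\<theta> (chart_inv \<phi> y) \<phi>) \<and>
      0 < chart_differential \<phi> y (v + N) \<and>
      chart_differential \<phi> y (v + N) < \<mu> * C ^ 2 + \<eta>"
    unfolding eventually_prod_filter fst_conv snd_conv by blast
  obtain d1 d2 where d: "0 < d1" "0 < d2"
    and P: "\<And>y. dist y ?y < d1 \<Longrightarrow> P y" and Q: "\<And>v. dist v w < d2 \<Longrightarrow> Q v"
    using PQ unfolding eventually_nhds_metric by blast
  show ?thesis
  proof (rule that)
    show "0 < min d1 d2"
      using d by simp
    have near: "P y" if "y \<in> ball ?y (min d1 d2)" for y
      using that by (intro P) (simp add: dist_commute)
    have near': "Q v" if "v \<in> ball w (min d1 d2)" for v
      using that by (intro Q) (simp add: dist_commute)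
    show "ball ?y (min d1 d2) \<subseteq> chart_range \<phi>"
    proof
      fix y assume y: "y \<in> ball ?y (min d1 d2)"
      have "Q w"
        using d by (intro Q) simp
      then show "y \<in> chart_range \<phi>"
        using *[OF near[OF y]] by blast
    qed
    show "chart_form \<phi> q (v + N) (v + N) < 0 \<and> chart_form \<phi> q (v - N) (v - N) < 0 \<and>
        chart_form \<phi> q (v + N) (\<theta> q \<phi>) < 0 \<and> 0 < chart_form \<phi> q (v - N) (\<theta> q \<phi>) \<and>
        0 < chart_differential \<phi> y (v + N) \<and> chart_differential \<phi> y (v + N) < \<mu> * C ^ 2 + \<eta>"
      if "y \<in> ball ?y (min d1 d2)" "v \<in> ball w (min d1 d2)" "q = chart_inv \<phi> y" for y v q
      using *[OF near[OF that(1)] near'[OF that(2)]] that(3) by simp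
  qed
qed

end


section \<open>Concatenation of piecewise causal curves\<close>

lemma smooth_curve_cong:
  assumes "\<And>u. u \<in> {a..b} \<Longrightarrow> \<beta> u = \<gamma> u" and "smooth_curve M A a b \<gamma>"
  shows "smooth_curve M A a b \<beta>"
proof -
  have "continuous_map (top_of_set {a..b}) M \<beta>"
    using assms by (intro continuous_map_eq[of "top_of_set {a..b}" M \<gamma> \<beta>]) (simp_all add: smooth_curve_def)
  moreover have "smooth_on {u \<in> {a..b}. \<beta> u \<in> chart_dom \<phi>} (coords \<phi> \<circ> \<beta>)" if "\<phi> \<in> A" for \<phi>
  proof -
    let ?S = "{u \<in> {a..b}. \<gamma> u \<in> chart_dom \<phi>}"
    have "{u \<in> {a..b}. \<beta> u \<in> chart_dom \<phi>} = ?S"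
      by (intro Collect_cong conj_cong refl) (simp only: assms(1))
    moreover have "smooth_on ?S (coords \<phi> \<circ> \<beta>) \<longleftrightarrow> smooth_on ?S (coords \<phi> \<circ> \<gamma>)"
      by (rule smooth_on_cong) (use assms(1) in simp)
    moreover have "smooth_on ?S (coords \<phi> \<circ> \<gamma>)"
      using assms(2) that unfolding smooth_curve_def by blast
    ultimately show ?thesis
      by (simp only:)
  qed
  ultimately show ?thesis
    using assms(2) unfolding smooth_curve_def by blast
qed

lemma velocity_cong:
  fixes A :: "('a, 'e::euclidean_space) chart set"
  assumes "\<And>u. u \<in> {a..b} \<Longrightarrow> \<beta> u = \<gamma> u" and "u \<in> {a..b}"
  shows "velocity A a b \<beta> u = velocity A a b \<gamma> u"
proof -
  have "vector_derivative (coords \<phi> \<circ> \<beta>) (at u within {a..b})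
      = vector_derivative (coords \<phi> \<circ> \<gamma>) (at u within {a..b})" for \<phi> :: "('a, 'e) chart"
  proof -
    have "((coords \<phi> \<circ> \<beta>) has_vector_derivative D) (at u within {a..b})
        \<longleftrightarrow> ((coords \<phi> \<circ> \<gamma>) has_vector_derivative D) (at u within {a..b})" for D
      unfolding has_vector_derivative_def
      by (rule has_derivative_within_cong) (use assms in auto)
    then show ?thesis
      by (simp add: vector_derivative_def)
  qed
  then show ?thesis
    by (simp only: velocity_def assms(1)[OF assms(2)])
qed

lemma causal_curve_cong:
  assumes "\<And>u. u \<in> {a..b} \<Longrightarrow> \<beta> u = \<gamma> u"
  shows future_causal_curve_cong:
      "future_causal_curve M A g \<theta> a b \<gamma> \<Longrightarrow> future_causal_curve M A g \<theta> a b \<beta>"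
    and past_causal_curve_cong:
      "past_causal_curve M A g \<theta> a b \<gamma> \<Longrightarrow> past_causal_curve M A g \<theta> a b \<beta>"
proof -
  have smooth: "smooth_curve M A a b \<beta>" if "smooth_curve M A a b \<gamma>"
    using smooth_curve_cong[of a b \<beta> \<gamma>] assms that by blast
  have eq: "velocity A a b \<beta> u = velocity A a b \<gamma> u" if "u \<in> {a..b}" for u
    using velocity_cong[of a b \<beta> \<gamma> u] assms that by blast
  show "future_causal_curve M A g \<theta> a b \<beta>" if "future_causal_curve M A g \<theta> a b \<gamma>"
    using that smooth unfolding future_causal_curve_def causal_curve_def by (metis eq assms)
  show "past_causal_curve M A g \<theta> a b \<beta>" if "past_causal_curve M A g \<theta> a b \<gamma>"
    using that smooth unfolding past_causal_curve_def causal_curve_def by (metis eq assms)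
qed

lemma partition_mono:
  assumes "partition N s" and "i \<le> j" and "j \<le> N"
  shows "s i \<le> s j"
  using assms(2,3)
proof (induction rule: dec_induct)
  case (step k)
  have "s k < s (Suc k)"
    using assms(1) step.prems by (simp add: partition_def)
  with step.IH step.prems show ?case
    by simp
qed simp

text \<open>The parameter interval is recorded so that curves over adjacent intervals can be concatenated
  without reparametrization.\<close>

definition joins ::
    "'a topology \<Rightarrow> ('a, 'e::euclidean_space) chart set \<Rightarrow> ('a, 'e) metric \<Rightarrow> ('a \<Rightarrow> ('a, 'e) tvec) \<Rightarrow>
     ('a \<Rightarrow> real) \<Rightarrow> real \<Rightarrow> real \<Rightarrow> 'a \<Rightarrow> 'a \<Rightarrow> real \<Rightarrow> bool" where
  "joins M A g \<theta> \<tau> u v p q L \<longleftrightarrow> (\<exists>N s \<beta>. piecewise_causal M A g \<theta> N s \<beta> \<and>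
     s 0 = u \<and> s N = v \<and> \<beta> u = p \<and> \<beta> v = q \<and> null_length \<tau> N s \<beta> \<le> L)"

lemma joins_mono:
  assumes "joins M A g \<theta> \<tau> u v p q L" and "L \<le> L'"
  shows "joins M A g \<theta> \<tau> u v p q L'"
proof -
  obtain N s \<beta> where "piecewise_causal M A g \<theta> N s \<beta>" "s 0 = u" "s N = v"
      "\<beta> u = p" "\<beta> v = q" "null_length \<tau> N s \<beta> \<le> L"
    using assms(1) by (auto simp: joins_def)
  with order_trans[OF _ assms(2)] show ?thesis
    unfolding joins_def by blast
qed

lemma joins_causal_curve:
  assumes "future_causal_curve M A g \<theta> u v \<beta> \<or> past_causal_curve M A g \<theta> u v \<beta>"
  shows "joins M A g \<theta> \<tau> u v (\<beta> u) (\<beta> v) \<bar>\<tau> (\<beta> v) - \<tau> (\<beta> u)\<bar>"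
proof -
  define s where "s i = (if i = 0 then u else v)" for i :: nat
  have "smooth_curve M A u v \<beta>"
    using assms by (auto simp: future_causal_curve_def past_causal_curve_def causal_curve_def)
  then have "piecewise_causal M A g \<theta> 1 s \<beta>"
    using assms by (auto simp: piecewise_causal_def partition_def s_def smooth_curve_def)
  moreover have "null_length \<tau> 1 s \<beta> \<le> \<bar>\<tau> (\<beta> v) - \<tau> (\<beta> u)\<bar>"
    by (simp add: null_length_def s_def)
  moreover have "s 0 = u" "s 1 = v"
    by (simp_all add: s_def)
  ultimately show ?thesis
    unfolding joins_def by blast
qed

lemma joins_trans:
  assumes "joins M A g \<theta> \<tau> u v p q L1" and "joins M A g \<theta> \<tau> v w q r L2"
  shows "joins M A g \<theta> \<tau> u w p r (L1 + L2)"
proof -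
  obtain N1 s1 \<beta>1 where 1: "piecewise_causal M A g \<theta> N1 s1 \<beta>1" "s1 0 = u" "s1 N1 = v"
      "\<beta>1 u = p" "\<beta>1 v = q" "null_length \<tau> N1 s1 \<beta>1 \<le> L1"
    using assms(1) by (auto simp: joins_def)
  obtain N2 s2 \<beta>2 where 2: "piecewise_causal M A g \<theta> N2 s2 \<beta>2" "s2 0 = v" "s2 N2 = w"
      "\<beta>2 v = q" "\<beta>2 w = r" "null_length \<tau> N2 s2 \<beta>2 \<le> L2"
    using assms(2) by (auto simp: joins_def)
  define s where "s i = (if i \<le> N1 then s1 i else s2 (i - N1))" for i
  define \<beta> where "\<beta> x = (if x \<le> v then \<beta>1 x else \<beta>2 x)" for x
  note part1 = 1(1)[unfolded piecewise_causal_def, THEN conjunct1]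
  note part2 = 2(1)[unfolded piecewise_causal_def, THEN conjunct1]
  have s_left: "s i = s1 i" if "i \<le> N1" for i
    using that by (simp add: s_def)
  have s_right: "s (N1 + i) = s2 i" for i
    using 1(3) 2(2) by (simp add: s_def)
  have \<beta>_left: "\<beta> x = \<beta>1 x" if "x \<le> v" for x
    using that by (simp add: \<beta>_def)
  have \<beta>_right: "\<beta> x = \<beta>2 x" if "v \<le> x" for x
    using that 1(5) 2(4) by (cases "x = v") (simp_all add: \<beta>_def)
  have le1: "s1 i \<le> v" if "i \<le> N1" for i
    using partition_mono[OF part1 that] 1(3) by simp
  have le2: "v \<le> s2 i" if "i \<le> N2" for i
    using partition_mono[OF part2 _ that, of 0] 2(2) by simp
  have uvw: "u \<le> v" "v \<le> w"
    using le1[of 0] le2[of N2] 1(2) 2(3) by simp_all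
  have split: "(\<exists>j<N2. i = N1 + j) \<or> i < N1" if "i < N1 + N2" for i
    using that by presburger
  have "partition (N1 + N2) s"
    unfolding partition_def
  proof (intro conjI allI impI)
    show "0 < N1 + N2"
      using part1 by (simp add: partition_def)
    fix i assume "i < N1 + N2"
    from split[OF this] show "s i < s (Suc i)"
    proof (elim disjE exE conjE)
      fix j assume "j < N2" "i = N1 + j"
      then show ?thesis
        using part2 s_right[of j] s_right[of "Suc j"] by (simp add: partition_def)
    next
      assume "i < N1"
      then show ?thesis
        using part1 by (simp add: partition_def s_left)
    qed
  qed
  moreover have "continuous_map (top_of_set {s 0..s (N1 + N2)}) M \<beta>"
  proof -
    have "continuous_map (top_of_set {u..w}) M \<beta>"
      unfolding \<beta>_def
    proof (rule continuous_map_cases_le)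
      have "{u..w} \<inter> {x \<in> {u..w}. x \<le> v} = {u..v}" "{u..w} \<inter> {x \<in> {u..w}. v \<le> x} = {v..w}"
        using uvw by auto
      then show "continuous_map (subtopology (top_of_set {u..w}) {x \<in> topspace (top_of_set {u..w}). x \<le> v}) M \<beta>1"
        and "continuous_map (subtopology (top_of_set {u..w}) {x \<in> topspace (top_of_set {u..w}). v \<le> x}) M \<beta>2"
        using 1(1-3) 2(1-3) by (simp_all add: subtopology_subtopology piecewise_causal_def)
    qed (use 1(5) 2(4) in auto)
    then show ?thesis
      using s_left[of 0] s_right[of N2] 1(2) 2(3) by simp
  qed
  moreover have "future_causal_curve M A g \<theta> (s i) (s (Suc i)) \<beta> \<or>
      past_causal_curve M A g \<theta> (s i) (s (Suc i)) \<beta>" if i: "i < N1 + N2" for i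
    using split[OF i]
  proof (elim disjE exE conjE)
    fix j assume j: "j < N2" "i = N1 + j"
    have "future_causal_curve M A g \<theta> (s2 j) (s2 (Suc j)) \<beta>2 \<or>
        past_causal_curve M A g \<theta> (s2 j) (s2 (Suc j)) \<beta>2"
      using 2(1) j(1) by (simp add: piecewise_causal_def)
    moreover have "\<beta> x = \<beta>2 x" if "x \<in> {s2 j..s2 (Suc j)}" for x
      using that le2[of j] j(1) by (intro \<beta>_right) simp
    ultimately have "future_causal_curve M A g \<theta> (s2 j) (s2 (Suc j)) \<beta> \<or>
        past_causal_curve M A g \<theta> (s2 j) (s2 (Suc j)) \<beta>"
      using causal_curve_cong[of "s2 j" "s2 (Suc j)" \<beta> \<beta>2] by blast
    then show ?thesis
      using s_right[of j] s_right[of "Suc j"] j(2) by simp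
  next
    assume j: "i < N1"
    have "future_causal_curve M A g \<theta> (s1 i) (s1 (Suc i)) \<beta>1 \<or>
        past_causal_curve M A g \<theta> (s1 i) (s1 (Suc i)) \<beta>1"
      using 1(1) j by (simp add: piecewise_causal_def)
    moreover have "\<beta> x = \<beta>1 x" if "x \<in> {s1 i..s1 (Suc i)}" for x
      using that le1[of "Suc i"] j by (intro \<beta>_left) simp
    ultimately have "future_causal_curve M A g \<theta> (s1 i) (s1 (Suc i)) \<beta> \<or>
        past_causal_curve M A g \<theta> (s1 i) (s1 (Suc i)) \<beta>"
      using causal_curve_cong[of "s1 i" "s1 (Suc i)" \<beta> \<beta>1] by blast
    then show ?thesis
      using j by (simp add: s_left)
  qed
  ultimately have "piecewise_causal M A g \<theta> (N1 + N2) s \<beta>"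
    by (simp add: piecewise_causal_def)
  moreover have "null_length \<tau> (N1 + N2) s \<beta> \<le> L1 + L2"
  proof -
    have "null_length \<tau> (N1 + N2) s \<beta> = (\<Sum>i<N1. \<bar>\<tau> (\<beta> (s (Suc i))) - \<tau> (\<beta> (s i))\<bar>)
        + (\<Sum>i<N2. \<bar>\<tau> (\<beta> (s (Suc (N1 + i)))) - \<tau> (\<beta> (s (N1 + i)))\<bar>)"
      unfolding null_length_def by (induction N2) simp_all
    also have "(\<Sum>i<N1. \<bar>\<tau> (\<beta> (s (Suc i))) - \<tau> (\<beta> (s i))\<bar>) = null_length \<tau> N1 s1 \<beta>1"
      unfolding null_length_def by (intro sum.cong) (simp_all add: s_left \<beta>_left le1)
    also have "(\<Sum>i<N2. \<bar>\<tau> (\<beta> (s (Suc (N1 + i)))) - \<tau> (\<beta> (s (N1 + i)))\<bar>) = null_length \<tau> N2 s2 \<beta>2"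
      unfolding null_length_def
    proof (rule sum.cong)
      fix i assume "i \<in> {..<N2}"
      moreover have "s (Suc (N1 + i)) = s2 (Suc i)"
        using s_right[of "Suc i"] by simp
      ultimately show "\<bar>\<tau> (\<beta> (s (Suc (N1 + i)))) - \<tau> (\<beta> (s (N1 + i)))\<bar>
          = \<bar>\<tau> (\<beta>2 (s2 (Suc i))) - \<tau> (\<beta>2 (s2 i))\<bar>"
        by (simp add: s_right \<beta>_right le2)
    qed simp
    finally show ?thesis
      using 1(6) 2(6) by simp
  qed
  moreover have "s 0 = u" "s (N1 + N2) = w" "\<beta> u = p" "\<beta> w = r"
    using s_left[of 0] s_right[of N2] \<beta>_left[of u] \<beta>_right[of w] uvw 1(2,4) 2(3,5) by simp_all
  ultimately show ?thesis
    unfolding joins_def by blast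
qed

lemma joins_imp_null_distance_le:
  assumes "joins M A g \<theta> \<tau> u v p q L"
  shows "null_distance M A g \<theta> \<tau> p q \<le> ennreal L"
proof (cases "p = q")
  case False
  obtain N s \<beta> where *: "piecewise_causal M A g \<theta> N s \<beta>" "s 0 = u" "s N = v"
      "\<beta> u = p" "\<beta> v = q" "null_length \<tau> N s \<beta> \<le> L"
    using assms by (auto simp: joins_def)
  have "null_distance M A g \<theta> \<tau> p q \<le> ennreal (null_length \<tau> N s \<beta>)"
    unfolding null_distance_def if_not_P[OF False] using * by (intro Inf_lower) blast
  also have "\<dots> \<le> ennreal L"
    using *(6) by (rule ennreal_leI)
  finally show ?thesis .
qed (simp add: null_distance_def)


section \<open>Zigzag curves along a curve in a level set\<close>

context temporal_spacetime
begin

lemma causal_line: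
  assumes "\<phi> \<in> A" and "a < b" and range: "\<And>u. u \<in> {a..b} \<Longrightarrow> y + u *\<^sub>R w \<in> chart_range \<phi>"
    and neg: "\<And>u q. u \<in> {a..b} \<Longrightarrow> q = chart_inv \<phi> (y + u *\<^sub>R w) \<Longrightarrow> chart_form \<phi> q w w < 0"
  defines "\<beta> \<equiv> \<lambda>u. chart_inv \<phi> (y + u *\<^sub>R w)"
  shows future_causal_line: "(\<And>u q. u \<in> {a..b} \<Longrightarrow> q = chart_inv \<phi> (y + u *\<^sub>R w) \<Longrightarrow>
        chart_form \<phi> q w (\<theta> q \<phi>) < 0) \<Longrightarrow> future_causal_curve M A g \<theta> a b \<beta>"
    and past_causal_line: "(\<And>u q. u \<in> {a..b} \<Longrightarrow> q = chart_inv \<phi> (y + u *\<^sub>R w) \<Longrightarrow>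
        0 < chart_form \<phi> q w (\<theta> q \<phi>)) \<Longrightarrow> past_causal_curve M A g \<theta> a b \<beta>"
proof -
  have line: "smooth_curve M A a b \<beta>"
    unfolding \<beta>_def by (rule smooth_curve_line[OF assms(1,2)]) (rule range)
  have vel: "velocity A a b \<beta> u = tvec_of A \<phi> (\<beta> u) w" if "u \<in> {a..b}" for u
    unfolding \<beta>_def by (rule velocity_line[OF assms(1,2) _ that]) (rule range)
  have chart: "\<phi> \<in> charts_at A (\<beta> u)" if "u \<in> {a..b}" for u
    using assms(1) chart_inv_in_dom[OF range[OF that]] by (simp add: charts_at_def \<beta>_def)
  have "causal A g (\<beta> u) (velocity A a b \<beta> u)" if u: "u \<in> {a..b}" for u
  proof -
    have neg': "chart_form \<phi> (\<beta> u) w w < 0"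
      using neg[OF u] by (simp add: \<beta>_def)
    have "velocity A a b \<beta> u \<noteq> (\<lambda>_. 0)"
    proof
      assume "velocity A a b \<beta> u = (\<lambda>_. 0)"
      then have "tvec_of A \<phi> (\<beta> u) w \<phi> = 0"
        using vel[OF u] by simp
      then have "w = 0"
        by (simp only: tvec_of_same_chart[OF chart[OF u]])
      then show False
        using neg' bilinear_lzero[OF bilinear_chart_form[OF chart[OF u]]] by simp
    qed
    then show ?thesis
      using neg' tvec_of_in_tangent_space[OF chart[OF u]]
      by (simp add: causal_def vel[OF u] chart_form_def)
  qed
  with line have causal: "causal_curve M A g a b \<beta>"
    by (simp add: causal_curve_def)
  have \<theta>: "chart_form \<phi> (\<beta> u) w (\<theta> (\<beta> u) \<phi>) = g (\<beta> u) (velocity A a b \<beta> u) (\<theta> (\<beta> u))"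
    if u: "u \<in> {a..b}" for u
    unfolding chart_form_def vel[OF u]
    by (simp only: tvec_of_component[OF
        orientation_in_tangent_space[OF charts_at_imp_topspace[OF chart[OF u]]] chart[OF u]])
  show "future_causal_curve M A g \<theta> a b \<beta>"
    if "\<And>u q. u \<in> {a..b} \<Longrightarrow> q = chart_inv \<phi> (y + u *\<^sub>R w) \<Longrightarrow> chart_form \<phi> q w (\<theta> q \<phi>) < 0"
    unfolding future_causal_curve_def future_directed_def
  proof (intro conjI causal ballI)
    fix u assume u: "u \<in> {a..b}"
    show "g (\<beta> u) (velocity A a b \<beta> u) (\<theta> (\<beta> u)) < 0"
      unfolding \<theta>[OF u, symmetric] by (rule that[OF u]) (simp add: \<beta>_def)
  qed
  show "past_causal_curve M A g \<theta> a b \<beta>"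
    if "\<And>u q. u \<in> {a..b} \<Longrightarrow> q = chart_inv \<phi> (y + u *\<^sub>R w) \<Longrightarrow> 0 < chart_form \<phi> q w (\<theta> q \<phi>)"
    unfolding past_causal_curve_def past_directed_def
  proof (intro conjI causal ballI)
    fix u assume u: "u \<in> {a..b}"
    show "0 < g (\<beta> u) (velocity A a b \<beta> u) (\<theta> (\<beta> u))"
      unfolding \<theta>[OF u, symmetric] by (rule that[OF u]) (simp add: \<beta>_def)
  qed
qed

lemma mean_value_on_line:
  assumes "\<phi> \<in> A" and "a < b" and "\<And>u. u \<in> {a..b} \<Longrightarrow> y + u *\<^sub>R w \<in> chart_range \<phi>"
  obtains u where "u \<in> {a..b}"
    and "f (chart_inv \<phi> (y + b *\<^sub>R w)) - f (chart_inv \<phi> (y + a *\<^sub>R w))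
      = (b - a) * chart_differential \<phi> (y + u *\<^sub>R w) w"
proof -
  have der: "((\<lambda>u. (f \<circ> chart_inv \<phi>) (y + u *\<^sub>R w)) has_derivative
      (\<lambda>h. chart_differential \<phi> (y + u *\<^sub>R w) (h *\<^sub>R w))) (at u within {a..b})"
    if "a \<le> u" "u \<le> b" for u
  proof -
    have "((\<lambda>u. y + u *\<^sub>R w) has_derivative (\<lambda>h. h *\<^sub>R w)) (at u within {a..b})"
      by (auto intro!: derivative_eq_intros)
    moreover have "((f \<circ> chart_inv \<phi>) has_derivative chart_differential \<phi> (y + u *\<^sub>R w)) (at (y + u *\<^sub>R w))"
      using that by (intro has_derivative_chart_differential assms) simp
    ultimately show ?thesis
      by (rule has_derivative_compose)
  qed
  have "\<exists>u\<in>{a<..<b}. (f \<circ> chart_inv \<phi>) (y + b *\<^sub>R w) - (f \<circ> chart_inv \<phi>) (y + a *\<^sub>R w)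
      = chart_differential \<phi> (y + u *\<^sub>R w) ((b - a) *\<^sub>R w)"
    by (rule mvt_simple[OF assms(2)]) (rule der)
  then obtain u where u: "u \<in> {a<..<b}"
    and eq: "(f \<circ> chart_inv \<phi>) (y + b *\<^sub>R w) - (f \<circ> chart_inv \<phi>) (y + a *\<^sub>R w)
      = chart_differential \<phi> (y + u *\<^sub>R w) ((b - a) *\<^sub>R w)"
    by blast
  have u': "u \<in> {a..b}" using u by simp
  have "linear (chart_differential \<phi> (y + u *\<^sub>R w))"
    by (rule has_derivative_linear[OF has_derivative_chart_differential[OF assms(1) assms(3)[OF u']]])
  then show ?thesis
    using that[OF u'] eq by (simp add: linear_scale)
qed

abbreviation joined :: "real \<Rightarrow> real \<Rightarrow> 'a \<Rightarrow> 'a \<Rightarrow> real \<Rightarrow> bool" where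
  "joined \<equiv> joins M A g \<theta> f"

definition speed :: "real \<Rightarrow> real \<Rightarrow> (real \<Rightarrow> 'a) \<Rightarrow> real \<Rightarrow> real" where
  "speed a b \<gamma> u =
     sqrt (induced_metric A g f (\<gamma> u) (velocity A a b \<gamma> u) (velocity A a b \<gamma> u))"

lemma level_curve_in_chart:
  assumes "smooth_curve M A a b \<gamma>" and level: "\<And>u. u \<in> {a..b} \<Longrightarrow> f (\<gamma> u) = t"
    and "x \<in> {a..b}" and "\<phi> \<in> charts_at A (\<gamma> x)"
    and "((coords \<phi> \<circ> \<gamma>) has_vector_derivative w) (at x within {a..b})"
  shows level_curve_tangent: "chart_differential \<phi> (coords \<phi> (\<gamma> x)) w = 0"
    and speed_in_chart: "speed a b \<gamma> x = sqrt (chart_form \<phi> (\<gamma> x) w w)"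
proof -
  have ab: "a < b"
    using assms(1) by (simp add: smooth_curve_def)
  note cont = smooth_curve_continuous[OF assms(1)]
  have \<phi>: "\<phi> \<in> A" "coords \<phi> (\<gamma> x) \<in> chart_range \<phi>"
    using assms(4) by (auto simp: charts_at_def)
  have "((f \<circ> \<gamma>) has_vector_derivative chart_differential \<phi> (coords \<phi> (\<gamma> x)) w) (at x within {a..b})"
    by (rule curve_chain_rule[OF cont assms(3,4,5) has_derivative_chart_differential[OF \<phi>]])
  moreover have "((f \<circ> \<gamma>) has_vector_derivative 0) (at x within {a..b})"
  proof (rule has_vector_derivative_transform[OF assms(3)])
    show "((\<lambda>_. t) has_vector_derivative 0) (at x within {a..b})"
      by (rule has_vector_derivative_const)
  qed (simp add: level)
  ultimately show 0: "chart_differential \<phi> (coords \<phi> (\<gamma> x)) w = 0"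
    using vector_derivative_unique_within_closed_interval[OF ab, of x] assms(3) by simp
  have vel: "velocity A a b \<gamma> x = tvec_of A \<phi> (\<gamma> x) w"
    by (rule velocity_eq_tvec_of[OF ab cont assms(3,4,5)])
  note T = tvec_of_in_tangent_space[OF assms(4), of w]
  have "differential A f (\<gamma> x) (tvec_of A \<phi> (\<gamma> x) w) = 0"
    by (simp only: differential_in_chart[OF differentiable assms(4) T]
        tvec_of_same_chart[OF assms(4)] 0)
  with T have "tvec_of A \<phi> (\<gamma> x) w \<in> level_tangent_space A f (\<gamma> x)"
    by (simp add: level_tangent_space_def)
  then show "speed a b \<gamma> x = sqrt (chart_form \<phi> (\<gamma> x) w w)"
    by (simp add: speed_def vel induced_metric_def chart_form_def)
qed

lemma continuous_speed:
  assumes "smooth_curve M A a b \<gamma>" and level: "\<And>u. u \<in> {a..b} \<Longrightarrow> f (\<gamma> u) = t"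
  shows "continuous_on {a..b} (speed a b \<gamma>)"
  unfolding continuous_on_def
proof
  fix x assume x: "x \<in> {a..b}"
  note cont = smooth_curve_continuous[OF assms(1)]
  have "\<gamma> x \<in> topspace M"
    using continuous_map_image_subset_topspace[OF cont] x by auto
  then obtain \<phi> where \<phi>: "\<phi> \<in> charts_at A (\<gamma> x)"
    using smooth_manifold unfolding smooth_manifold_def charts_at_def by blast
  then have \<phi>': "\<phi> \<in> A" "\<gamma> x \<in> chart_dom \<phi>" "coords \<phi> (\<gamma> x) \<in> chart_range \<phi>"
    by (auto simp: charts_at_def)
  obtain c where c: "\<And>u. u \<in> {a..b} \<Longrightarrow> \<gamma> u \<in> chart_dom \<phi> \<Longrightarrow>
      ((coords \<phi> \<circ> \<gamma>) has_vector_derivative c u) (at u within {a..b})"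
    and lim: "(c \<longlongrightarrow> c x) (at x within {a..b})"
    using smooth_curve_in_chart[OF assms(1) x \<phi>] by blast
  have speed: "speed a b \<gamma> u = sqrt (chart_form \<phi> (chart_inv \<phi> (coords \<phi> (\<gamma> u))) (c u) (c u))"
    if "u \<in> {a..b}" "\<gamma> u \<in> chart_dom \<phi>" for u
    using speed_in_chart[OF assms that(1) _ c[OF that]] that \<phi>'(1)
    by (simp add: charts_at_def chart_inv_coords)
  have "continuous (at x within {a..b}) (coords \<phi> \<circ> \<gamma>)"
    using c[OF x \<phi>'(2)] by (rule has_vector_derivative_continuous)
  then have "((\<lambda>u. coords \<phi> (\<gamma> u)) \<longlongrightarrow> coords \<phi> (\<gamma> x)) (at x within {a..b})"
    by (simp add: continuous_within o_def)
  from tendsto_real_sqrt[OF tendsto_chart_form[OF \<phi>'(1,3) this lim lim]]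
  have "((\<lambda>u. sqrt (chart_form \<phi> (chart_inv \<phi> (coords \<phi> (\<gamma> u))) (c u) (c u)))
      \<longlongrightarrow> speed a b \<gamma> x) (at x within {a..b})"
    by (simp only: speed[OF x \<phi>'(2)])
  moreover have "\<forall>\<^sub>F u in at x within {a..b}. u \<in> {a..b}"
    by (simp add: eventually_at_filter)
  from eventually_conj[OF this eventually_in_open[OF cont openin_chart_dom[OF \<phi>'(1)] x \<phi>'(2)]]
  have "\<forall>\<^sub>F u in at x within {a..b}.
      sqrt (chart_form \<phi> (chart_inv \<phi> (coords \<phi> (\<gamma> u))) (c u) (c u)) = speed a b \<gamma> u"
    by (rule eventually_mono) (simp only: speed)
  ultimately show "(speed a b \<gamma> \<longlongrightarrow> speed a b \<gamma> x) (at x within {a..b})"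
    by (rule Lim_transform_eventually)
qed

text \<open>The interval \<open>[u, v]\<close> contains \<open>x\<close>, so differentiability of \<open>\<gamma>\<close> at the single point \<open>x\<close> is
  enough to make the difference quotient over \<open>[u, v]\<close> close to the derivative. One half of \<open>\<epsilon>\<close> makes
  the directions of the two legs strictly timelike, the other half absorbs the variation of the slope
  of \<open>f\<close> along the first leg.\<close>

lemma local_zigzag:
  assumes "smooth_curve M A a b \<gamma>" and level: "\<And>u. u \<in> {a..b} \<Longrightarrow> f (\<gamma> u) = t"
    and x: "x \<in> {a..b}" and "0 < C" and "0 < \<epsilon>"
    and grad: "g (\<gamma> x) (gradient A g f (\<gamma> x)) (gradient A g f (\<gamma> x)) = - (C ^ 2)"
  obtains d where "0 < d" and "\<And>u v. \<lbrakk>a \<le> u; u \<le> x; x \<le> v; v \<le> b; u < v; v - u < d\<rbrakk> \<Longrightarrow>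
      joined u v (\<gamma> u) (\<gamma> v) (C * (speed a b \<gamma> x + \<epsilon>) * (v - u))"
proof -
  note cont = smooth_curve_continuous[OF assms(1)]
  have "\<gamma> x \<in> topspace M"
    using continuous_map_image_subset_topspace[OF cont] x by auto
  then obtain \<phi> where \<phi>: "\<phi> \<in> charts_at A (\<gamma> x)"
    using smooth_manifold unfolding smooth_manifold_def charts_at_def by blast
  then have \<phi>': "\<phi> \<in> A" "\<gamma> x \<in> chart_dom \<phi>"
    by (auto simp: charts_at_def)
  define X where "X = coords \<phi> (\<gamma> x)"
  define \<kappa> where "\<kappa> = coords \<phi> \<circ> \<gamma>"
  obtain w where w: "(\<kappa> has_vector_derivative w) (at x within {a..b})"
    using smooth_curve_in_chart[OF assms(1) x \<phi>] \<phi>'(2) x unfolding \<kappa>_def by blast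
  define \<sigma> where "\<sigma> = speed a b \<gamma> x"
  have tangent: "chart_differential \<phi> (coords \<phi> (\<gamma> x)) w = 0"
    and \<sigma>: "\<sigma> = sqrt (chart_form \<phi> (\<gamma> x) w w)"
    using level_curve_in_chart[OF assms(1) level x \<phi>] w by (simp_all add: \<kappa>_def \<sigma>_def)
  have "0 \<le> \<sigma>"
    using level_tangent_nonneg[OF \<phi> tangent] by (simp add: \<sigma>)
  define \<mu> where "\<mu> = (\<sigma> + \<epsilon> / 2) / C"
  have \<mu>: "0 < \<mu>" "\<sigma> < \<mu> * C" "\<mu> * C ^ 2 + C * \<epsilon> / 2 = C * (\<sigma> + \<epsilon>)" "0 < C * \<epsilon> / 2"
    using \<open>0 \<le> \<sigma>\<close> assms(4,5) by (simp_all add: \<mu>_def field_simps power2_eq_square)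
  define N where "N = \<mu> *\<^sub>R up \<phi> (\<gamma> x)"
  obtain r where r: "0 < r" "ball X r \<subseteq> chart_range \<phi>"
    and legs: "\<And>y v q. \<lbrakk>y \<in> ball X r; v \<in> ball w r; q = chart_inv \<phi> y\<rbrakk> \<Longrightarrow>
      chart_form \<phi> q (v + N) (v + N) < 0 \<and> chart_form \<phi> q (v - N) (v - N) < 0 \<and>
      chart_form \<phi> q (v + N) (\<theta> q \<phi>) < 0 \<and> 0 < chart_form \<phi> q (v - N) (\<theta> q \<phi>) \<and>
      0 < chart_differential \<phi> y (v + N) \<and> chart_differential \<phi> y (v + N) < C * (\<sigma> + \<epsilon>)"
    using legs_stable[OF \<phi> tangent \<mu>(1) \<mu>(2)[unfolded \<sigma>] \<mu>(4) assms(4) grad]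
    unfolding \<mu>(3) N_def X_def by blast
  \<comment> \<open>Both legs over \<open>[u, v]\<close> stay within distance \<open>(v - u) K\<close> of \<open>X\<close>.\<close>
  define K where "K = 2 * norm w + 2 * r + norm N"
  have "0 < K"
    using r(1) by (simp add: K_def add_pos_nonneg add_nonneg_pos)
  obtain d1 where d1: "0 < d1" and lin: "\<And>u. \<lbrakk>u \<in> {a..b}; \<bar>u - x\<bar> < d1\<rbrakk> \<Longrightarrow>
      norm (\<kappa> u - X - (u - x) *\<^sub>R w) \<le> r / 2 * \<bar>u - x\<bar>"
    using w r(1) unfolding has_vector_derivative_def has_derivative_within_alt
    by (auto simp: X_def \<kappa>_def dest!: spec[of _ "r / 2"])
  obtain d2 where d2: "0 < d2" and dom: "\<And>u. \<lbrakk>u \<in> {a..b}; \<bar>u - x\<bar> < d2\<rbrakk> \<Longrightarrow> \<gamma> u \<in> chart_dom \<phi>"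
    using eventually_in_open[OF cont openin_chart_dom[OF \<phi>'(1)] x \<phi>'(2)] \<phi>'(2)
    unfolding eventually_at dist_real_def by (metis abs_le_zero_iff not_le right_minus_eq)
  show ?thesis
  proof (rule that[of "min (min d1 d2) (r / K)"])
    show "0 < min (min d1 d2) (r / K)"
      using d1 d2 r(1) \<open>0 < K\<close> by simp
    fix u v assume uv: "a \<le> u" "u \<le> x" "x \<le> v" "v \<le> b" "u < v" "v - u < min (min d1 d2) (r / K)"
    have small: "(v - u) * K < r"
      using uv(6) \<open>0 < K\<close> by (simp add: field_simps)
    have u: "u \<in> {a..b}" "\<bar>u - x\<bar> < d1" "\<bar>u - x\<bar> < d2" and v: "v \<in> {a..b}" "\<bar>v - x\<bar> < d1" "\<bar>v - x\<bar> < d2"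
      using uv by auto
    define m where "m = (u + v) / 2"
    define W where "W = (1 / (v - u)) *\<^sub>R (\<kappa> v - \<kappa> u)"
    have m: "u < m" "m < v" "m - u = (v - u) / 2" "v - m = (v - u) / 2"
      using uv(5) by (simp_all add: m_def field_simps)
    have W: "(v - u) *\<^sub>R W = \<kappa> v - \<kappa> u"
      using uv(5) by (simp add: W_def)
    \<comment> \<open>As \<open>u \<le> x \<le> v\<close>, the error terms at \<open>u\<close> and \<open>v\<close> add up to a multiple of \<open>v - u\<close>.\<close>
    have "norm ((\<kappa> v - X - (v - x) *\<^sub>R w) - (\<kappa> u - X - (u - x) *\<^sub>R w)) \<le> r / 2 * \<bar>v - x\<bar> + r / 2 * \<bar>u - x\<bar>"
      by (rule order_trans[OF norm_triangle_ineq4 add_mono[OF lin[OF v(1,2)] lin[OF u(1,2)]]])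
    also have "(\<kappa> v - X - (v - x) *\<^sub>R w) - (\<kappa> u - X - (u - x) *\<^sub>R w) = (v - u) *\<^sub>R (W - w)"
      unfolding scaleR_diff_right W by (simp add: algebra_simps)
    also have "r / 2 * \<bar>v - x\<bar> + r / 2 * \<bar>u - x\<bar> = (v - u) * (r / 2)"
      using uv by (simp add: field_simps)
    finally have "norm (W - w) \<le> r / 2"
      using uv(5) by simp
    then have Ww: "W \<in> ball w r"
      using r(1) by (simp add: dist_norm norm_minus_commute)
    have normW: "norm W \<le> norm w + r"
      using \<open>norm (W - w) \<le> r / 2\<close> norm_triangle_ineq2[of W w] r(1) by simp
    have start: "norm (\<kappa> z - X) \<le> (v - u) * (norm w + r)" if "z = u \<or> z = v" for z
    proof -
      have z: "z \<in> {a..b}" "\<bar>z - x\<bar> < d1" "\<bar>z - x\<bar> \<le> v - u"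
        using that u v uv by auto
      have "norm (\<kappa> z - X) \<le> norm (\<kappa> z - X - (z - x) *\<^sub>R w) + norm ((z - x) *\<^sub>R w)"
        using norm_triangle_ineq[of "\<kappa> z - X - (z - x) *\<^sub>R w" "(z - x) *\<^sub>R w"] by simp
      also have "\<dots> \<le> r / 2 * \<bar>z - x\<bar> + \<bar>z - x\<bar> * norm w"
        using lin[OF z(1,2)] by simp
      also have "\<dots> = \<bar>z - x\<bar> * (norm w + r / 2)"
        by (simp add: algebra_simps)
      also have "\<dots> \<le> (v - u) * (norm w + r)"
        using z(3) r(1) by (intro mult_mono) auto
      finally show ?thesis .
    qed
    have in_ball: "\<kappa> z + h *\<^sub>R V \<in> ball X r"
      if z: "z = u \<or> z = v" and h: "\<bar>h\<bar> \<le> v - u" and V: "norm V \<le> norm W + norm N" for z h V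
    proof -
      have "norm (\<kappa> z + h *\<^sub>R V - X) \<le> norm (\<kappa> z - X) + norm (h *\<^sub>R V)"
        using norm_triangle_ineq[of "\<kappa> z - X" "h *\<^sub>R V"] by (simp add: algebra_simps)
      also have "norm (h *\<^sub>R V) \<le> (v - u) * (norm w + r + norm N)"
        using h V normW by (simp add: mult_mono)
      finally have "norm (\<kappa> z + h *\<^sub>R V - X) \<le> (v - u) * K"
        using start[OF z] by (simp add: K_def algebra_simps)
      then show ?thesis
        using small by (simp add: dist_norm norm_minus_commute)
    qed
    define y1 where "y1 = \<kappa> u - u *\<^sub>R (W + N)"
    define y2 where "y2 = \<kappa> v - v *\<^sub>R (W - N)"
    have ball1: "y1 + z *\<^sub>R (W + N) \<in> ball X r" if "z \<in> {u..m}" for z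
    proof -
      have "y1 + z *\<^sub>R (W + N) = \<kappa> u + (z - u) *\<^sub>R (W + N)"
        by (simp add: y1_def algebra_simps)
      then show ?thesis
        using in_ball[of u "z - u" "W + N"] that m norm_triangle_ineq[of W N] by simp
    qed
    have ball2: "y2 + z *\<^sub>R (W - N) \<in> ball X r" if "z \<in> {m..v}" for z
    proof -
      have "y2 + z *\<^sub>R (W - N) = \<kappa> v + (z - v) *\<^sub>R (W - N)"
        by (simp add: y2_def algebra_simps)
      then show ?thesis
        using in_ball[of v "z - v" "W - N"] that m norm_triangle_ineq4[of W N] by simp
    qed
    note range1 = subsetD[OF r(2) ball1] and range2 = subsetD[OF r(2) ball2]
    define \<beta>1 where "\<beta>1 z = chart_inv \<phi> (y1 + z *\<^sub>R (W + N))" for z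
    define \<beta>2 where "\<beta>2 z = chart_inv \<phi> (y2 + z *\<^sub>R (W - N))" for z
    have 1: "future_causal_curve M A g \<theta> u m \<beta>1"
      unfolding \<beta>1_def
      using legs[OF ball1 Ww] by (intro future_causal_line[OF \<phi>'(1) m(1) range1]) blast+
    have 2: "past_causal_curve M A g \<theta> m v \<beta>2"
      unfolding \<beta>2_def
      using legs[OF ball2 Ww] by (intro past_causal_line[OF \<phi>'(1) m(2) range2]) blast+
    have ends: "\<beta>1 u = \<gamma> u" "\<beta>2 v = \<gamma> v"
      using chart_inv_coords[OF \<phi>'(1) dom[OF u(1,3)]] chart_inv_coords[OF \<phi>'(1) dom[OF v(1,3)]]
      by (simp_all add: \<beta>1_def \<beta>2_def y1_def y2_def \<kappa>_def)
    have "y1 + m *\<^sub>R (W + N) = y2 + m *\<^sub>R (W - N)"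
    proof -
      have "y1 + m *\<^sub>R (W + N) = \<kappa> u + (m - u) *\<^sub>R (W + N)"
        by (simp add: y1_def algebra_simps)
      also have "\<dots> = \<kappa> u + (v - u) *\<^sub>R W - ((v - u) / 2) *\<^sub>R (W - N)"
      proof -
        have "(v - u) *\<^sub>R W = ((v - u) / 2) *\<^sub>R W + ((v - u) / 2) *\<^sub>R W"
          by (simp flip: scaleR_add_left)
        then show ?thesis
          unfolding m(3) by (simp only: scaleR_add_right scaleR_diff_right) simp
      qed
      also have "\<dots> = \<kappa> v - (v - m) *\<^sub>R (W - N)"
        unfolding W m(4) by simp
      also have "\<dots> = y2 + m *\<^sub>R (W - N)"
        by (simp add: y2_def algebra_simps)
      finally show ?thesis .
    qed
    then have middle: "\<beta>2 m = \<beta>1 m"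
      by (simp add: \<beta>1_def \<beta>2_def)
    obtain z where z: "z \<in> {u..m}"
      and "f (\<beta>1 m) - f (\<beta>1 u) = (m - u) * chart_differential \<phi> (y1 + z *\<^sub>R (W + N)) (W + N)"
      unfolding \<beta>1_def by (rule mean_value_on_line[OF \<phi>'(1) m(1) range1])
    then have height: "f (\<beta>1 m) - t = (v - u) / 2 * chart_differential \<phi> (y1 + z *\<^sub>R (W + N)) (W + N)"
      using level[OF u(1)] by (simp add: ends m(3))
    have "\<bar>f (\<beta>1 m) - t\<bar> \<le> (v - u) / 2 * (C * (\<sigma> + \<epsilon>))"
      using legs[OF ball1[OF z] Ww refl] uv(5) unfolding height by (simp add: abs_mult mult_left_mono)
    then have "\<bar>f (\<beta>1 m) - f (\<beta>1 u)\<bar> + \<bar>f (\<beta>2 v) - f (\<beta>2 m)\<bar> \<le> C * (\<sigma> + \<epsilon>) * (v - u)"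
      using level[OF u(1)] level[OF v(1)] by (simp add: ends middle abs_minus_commute algebra_simps)
    moreover have "joined u m (\<gamma> u) (\<beta>1 m) \<bar>f (\<beta>1 m) - f (\<beta>1 u)\<bar>"
      using joins_causal_curve[OF disjI1[OF 1], of f] by (simp only: ends)
    from joins_trans[OF this, of v "\<gamma> v" "\<bar>f (\<beta>2 v) - f (\<beta>2 m)\<bar>"]
    have "joined u v (\<gamma> u) (\<gamma> v) (\<bar>f (\<beta>1 m) - f (\<beta>1 u)\<bar> + \<bar>f (\<beta>2 v) - f (\<beta>2 m)\<bar>)"
      using joins_causal_curve[OF disjI2[OF 2], of f] by (simp only: ends middle)
    ultimately show "joined u v (\<gamma> u) (\<gamma> v) (C * (speed a b \<gamma> x + \<epsilon>) * (v - u))"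
      unfolding \<sigma>_def by (rule joins_mono[rotated])
  qed
qed

end


section \<open>From local estimates to the length of a curve\<close>

context temporal_spacetime
begin

text \<open>The bound is additive over adjacent intervals and, by continuity of the speed, follows from
  the local estimate on short intervals around each point; a compactness argument does the rest.\<close>

lemma zigzag_along_smooth_curve:
  assumes "smooth_curve M A a b \<gamma>" and level: "\<And>u. u \<in> {a..b} \<Longrightarrow> f (\<gamma> u) = t"
    and "0 < C" and "0 < \<epsilon>"
    and grad: "\<And>u. u \<in> {a..b} \<Longrightarrow> g (\<gamma> u) (gradient A g f (\<gamma> u)) (gradient A g f (\<gamma> u)) = - (C ^ 2)"
  shows "joined a b (\<gamma> a) (\<gamma> b) (C * (integral {a..b} (speed a b \<gamma>) + \<epsilon> * (b - a)))"
proof -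
  have ab: "a < b"
    using assms(1) by (simp add: smooth_curve_def)
  have cont: "continuous_on {a..b} (speed a b \<gamma>)"
    using assms(1) level by (rule continuous_speed)
  have int: "speed a b \<gamma> integrable_on {u..v}" if "a \<le> u" "v \<le> b" for u v
    using that by (intro integrable_continuous_real continuous_on_subset[OF cont]) auto
  let ?J = "\<lambda>u v. integral {u..v} (speed a b \<gamma>)"
  define P where "P u v \<longleftrightarrow> a \<le> u \<longrightarrow> u < v \<longrightarrow> v \<le> b \<longrightarrow>
    joined u v (\<gamma> u) (\<gamma> v) (C * (?J u v + \<epsilon> * (v - u)))" for u v
  have "P a b"
  proof (rule Bolzano)
    show "a \<le> b" using ab by simp
  next
    fix u v w assume P: "P u v" "P v w" and le: "u \<le> v" "v \<le> w"
    show "P u w"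
      unfolding P_def
    proof (intro impI)
      assume uw: "a \<le> u" "u < w" "w \<le> b"
      show "joined u w (\<gamma> u) (\<gamma> w) (C * (?J u w + \<epsilon> * (w - u)))"
      proof (cases "u = v \<or> v = w")
        case True
        then show ?thesis
          using P uw by (auto simp: P_def)
      next
        case False
        then have "joined u v (\<gamma> u) (\<gamma> v) (C * (?J u v + \<epsilon> * (v - u)))"
          and "joined v w (\<gamma> v) (\<gamma> w) (C * (?J v w + \<epsilon> * (w - v)))"
          using P le uw by (simp_all add: P_def)
        then have "joined u w (\<gamma> u) (\<gamma> w) (C * (?J u v + \<epsilon> * (v - u)) + C * (?J v w + \<epsilon> * (w - v)))"
          by (rule joins_trans)
        moreover have J: "?J u v + ?J v w = ?J u w"
          using le int[OF uw(1,3)] by (rule Henstock_Kurzweil_Integration.integral_combine)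
        have "C * (?J u v + \<epsilon> * (v - u)) + C * (?J v w + \<epsilon> * (w - v)) = C * (?J u w + \<epsilon> * (w - u))"
          unfolding J[symmetric] by (simp add: algebra_simps)
        ultimately show ?thesis
          by simp
      qed
    qed
  next
    fix x assume "a \<le> x" "x \<le> b"
    then have x: "x \<in> {a..b}" by simp
    obtain d1 where d1: "0 < d1" and zigzag: "\<And>u v. \<lbrakk>a \<le> u; u \<le> x; x \<le> v; v \<le> b; u < v; v - u < d1\<rbrakk> \<Longrightarrow>
        joined u v (\<gamma> u) (\<gamma> v) (C * (speed a b \<gamma> x + \<epsilon> / 2) * (v - u))"
      using local_zigzag[of a b \<gamma> t x C "\<epsilon> / 2"] assms(1,3,4) level x grad[OF x] by auto
    obtain d2 where d2: "0 < d2" and near: "\<And>z. \<lbrakk>z \<in> {a..b}; \<bar>z - x\<bar> < d2\<rbrakk> \<Longrightarrow>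
        \<bar>speed a b \<gamma> z - speed a b \<gamma> x\<bar> < \<epsilon> / 2"
      using cont[unfolded continuous_on_iff, rule_format, OF x, of "\<epsilon> / 2"] assms(4)
      by (auto simp: dist_real_def)
    show "\<exists>d>0. \<forall>u v. u \<le> x \<and> x \<le> v \<and> v - u < d \<longrightarrow> P u v"
    proof (intro exI[of _ "min d1 d2"] conjI allI impI)
      show "0 < min d1 d2" using d1 d2 by simp
      fix u v assume uxv: "u \<le> x \<and> x \<le> v \<and> v - u < min d1 d2"
      show "P u v"
        unfolding P_def
      proof (intro impI)
        assume uv: "a \<le> u" "u < v" "v \<le> b"
        have "speed a b \<gamma> x - \<epsilon> / 2 \<le> speed a b \<gamma> z" if "z \<in> {u..v}" for z
        proof -
          have "\<bar>speed a b \<gamma> z - speed a b \<gamma> x\<bar> < \<epsilon> / 2"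
            using that uxv uv by (intro near) auto
          then show ?thesis by linarith
        qed
        then have "integral {u..v} (\<lambda>_. speed a b \<gamma> x - \<epsilon> / 2) \<le> ?J u v"
          by (intro integral_le int uv integrable_const_ivl) simp
        then have "(v - u) * (speed a b \<gamma> x - \<epsilon> / 2) \<le> ?J u v"
          using uv(2) by simp
        moreover have "(v - u) * (speed a b \<gamma> x + \<epsilon> / 2)
            = (v - u) * (speed a b \<gamma> x - \<epsilon> / 2) + \<epsilon> * (v - u)"
          by (simp add: field_simps)
        ultimately have "(v - u) * (speed a b \<gamma> x + \<epsilon> / 2) \<le> ?J u v + \<epsilon> * (v - u)"
          by linarith
        then have "C * ((v - u) * (speed a b \<gamma> x + \<epsilon> / 2)) \<le> C * (?J u v + \<epsilon> * (v - u))"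
          using assms(3) by (intro mult_left_mono) simp_all
        then have "C * (speed a b \<gamma> x + \<epsilon> / 2) * (v - u) \<le> C * (?J u v + \<epsilon> * (v - u))"
          by (simp only: mult_ac)
        with zigzag[of u v] show "joined u v (\<gamma> u) (\<gamma> v) (C * (?J u v + \<epsilon> * (v - u)))"
          using uxv uv joins_mono by simp
      qed
    qed
  qed
  then show ?thesis
    using ab by (simp add: P_def)
qed

lemma zigzag_along_level_curve:
  assumes "piecewise_smooth_in M A (level_set M f t) N s \<gamma>" and "0 < C" and "0 < \<epsilon>"
    and grad: "\<And>p. p \<in> level_set M f t \<Longrightarrow> g p (gradient A g f p) (gradient A g f p) = - (C ^ 2)"
  shows "joined (s 0) (s N) (\<gamma> (s 0)) (\<gamma> (s N))
    (C * (curve_length A (induced_metric A g f) N s \<gamma> + \<epsilon> * (s N - s 0)))"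
proof -
  have part: "partition N s" and image: "\<gamma> ` {s 0..s N} \<subseteq> level_set M f t"
    and smooth_piece: "\<And>i. i < N \<Longrightarrow> smooth_curve M A (s i) (s (Suc i)) \<gamma>"
    using assms(1) by (simp_all add: piecewise_smooth_in_def)
  let ?L = "\<lambda>k. curve_length A (induced_metric A g f) k s \<gamma>"
  have piece: "joined (s i) (s (Suc i)) (\<gamma> (s i)) (\<gamma> (s (Suc i)))
      (C * (?L (Suc i) - ?L i + \<epsilon> * (s (Suc i) - s i)))" if i: "i < N" for i
  proof -
    have "\<gamma> u \<in> level_set M f t" if "u \<in> {s i..s (Suc i)}" for u
    proof -
      have "u \<in> {s 0..s N}"
        using that i partition_mono[OF part, of 0 i] partition_mono[OF part, of "Suc i" N] by simp
      then show ?thesis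
        using image by blast
    qed
    then have "joined (s i) (s (Suc i)) (\<gamma> (s i)) (\<gamma> (s (Suc i)))
        (C * (integral {s i..s (Suc i)} (speed (s i) (s (Suc i)) \<gamma>) + \<epsilon> * (s (Suc i) - s i)))"
      using grad by (intro zigzag_along_smooth_curve[OF smooth_piece[OF i] _ assms(2,3), where t = t])
        (auto simp: level_set_def)
    then show ?thesis
      by (simp add: curve_length_def speed_def[abs_def])
  qed
  have "joined (s 0) (s k) (\<gamma> (s 0)) (\<gamma> (s k)) (C * (?L k + \<epsilon> * (s k - s 0)))" if "1 \<le> k" "k \<le> N" for k
    using that
  proof (induction rule: dec_induct)
    case base
    then show ?case
      using piece[of 0] by (simp add: curve_length_def)
  next
    case (step k)
    have "joined (s 0) (s k) (\<gamma> (s 0)) (\<gamma> (s k)) (C * (?L k + \<epsilon> * (s k - s 0)))"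
      using step by simp
    from joins_trans[OF this piece[of k]] step.prems
    have "joined (s 0) (s (Suc k)) (\<gamma> (s 0)) (\<gamma> (s (Suc k)))
        (C * (?L k + \<epsilon> * (s k - s 0)) + C * (?L (Suc k) - ?L k + \<epsilon> * (s (Suc k) - s k)))"
      by simp
    moreover have "C * (?L k + \<epsilon> * (s k - s 0)) + C * (?L (Suc k) - ?L k + \<epsilon> * (s (Suc k) - s k))
        = C * (?L (Suc k) + \<epsilon> * (s (Suc k) - s 0))"
      by (simp add: algebra_simps)
    ultimately show ?case
      by (simp only:)
  qed
  from this[of N] show ?thesis
    using part by (simp add: partition_def)
qed

lemma null_distance_le_curve_length:
  assumes "piecewise_smooth_in M A (level_set M f t) N s \<gamma>" and "0 < C"
    and "\<And>p. p \<in> level_set M f t \<Longrightarrow> g p (gradient A g f p) (gradient A g f p) = - (C ^ 2)"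
  shows "null_distance M A g \<theta> f (\<gamma> (s 0)) (\<gamma> (s N))
    \<le> ennreal C * ennreal (curve_length A (induced_metric A g f) N s \<gamma>)"
proof (rule ennreal_le_epsilon)
  fix e :: real assume "0 < e"
  let ?L = "curve_length A (induced_metric A g f) N s \<gamma>"
  have part: "partition N s"
    using assms(1) by (simp add: piecewise_smooth_in_def)
  have T: "0 < s N - s 0"
    using partition_mono[OF part, of "Suc 0" N] part by (force simp: partition_def)
  \<comment> \<open>The errors \<open>C \<epsilon>\<close> per unit of parameter add up to \<open>e\<close>.\<close>
  define \<epsilon> where "\<epsilon> = e / (C * (s N - s 0))"
  have "0 < \<epsilon>"
    using \<open>0 < e\<close> assms(2) T by (simp add: \<epsilon>_def)
  from joins_imp_null_distance_le[OF zigzag_along_level_curve[OF assms(1,2) this assms(3)]]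
  have "null_distance M A g \<theta> f (\<gamma> (s 0)) (\<gamma> (s N)) \<le> ennreal (C * (?L + \<epsilon> * (s N - s 0)))" .
  also have "C * (?L + \<epsilon> * (s N - s 0)) = C * ?L + e"
    using assms(2) T by (simp add: \<epsilon>_def distrib_left)
  also have "ennreal (C * ?L + e) \<le> ennreal (C * max 0 ?L + e)"
    using assms(2) by (intro ennreal_leI) simp
  also have "\<dots> = ennreal C * ennreal ?L + ennreal e"
    using assms(2) \<open>0 < e\<close>
    by (cases "0 \<le> ?L") (simp_all add: ennreal_plus ennreal_mult' ennreal_neg max_def)
  finally show "null_distance M A g \<theta> f (\<gamma> (s 0)) (\<gamma> (s N)) \<le> ennreal C * ennreal ?L + ennreal e" .
qed

end

section \<open>Comparison of the distances\<close>

theorem theorem1p2: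
  fixes M :: "'a topology"
    and A :: "('a, 'e::euclidean_space) chart set"
    and g :: "('a, 'e) metric"
    and \<theta> :: "'a \<Rightarrow> ('a, 'e) tvec"
    and f :: "'a \<Rightarrow> real"
    and n :: nat and t C :: real
  assumes "spacetime n M A g \<theta>"
    and "smooth_function A f"
    and "temporal_function M A g \<theta> f"
    and "C > 0"
    and "level_set M f t \<noteq> {}"
    and "\<forall>p\<in>level_set M f t. g p (gradient A g f p) (gradient A g f p) = - (C ^ 2)"
  shows "\<forall>p\<in>level_set M f t. \<forall>q\<in>level_set M f t.
    null_distance M A g \<theta> f p q
      \<le> ennreal C * riemannian_distance M A (level_set M f t) (induced_metric A g f) p q"
proof (intro ballI)
  interpret temporal_spacetime n M A g \<theta> f
    using assms(1-3) by (simp add: temporal_spacetime_def)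
  fix p q
  let ?S = "{ennreal (curve_length A (induced_metric A g f) N s \<gamma>) | N s \<gamma>.
       piecewise_smooth_in M A (level_set M f t) N s \<gamma> \<and> \<gamma> (s 0) = p \<and> \<gamma> (s N) = q}"
  have C: "ennreal C > 0" "ennreal C < top"
    using assms(4) by simp_all
  have "null_distance M A g \<theta> f p q \<le> ennreal C * l" if "l \<in> ?S" for l
    using that null_distance_le_curve_length assms(4,6) by blast
  then have "null_distance M A g \<theta> f p q / ennreal C \<le> Inf ?S"
    by (intro Inf_greatest divide_le_posI_ennreal C(1))
  then have "ennreal C * (null_distance M A g \<theta> f p q / ennreal C) \<le> ennreal C * Inf ?S"
    by (rule mult_left_mono) simp
  moreover have "ennreal C * (null_distance M A g \<theta> f p q / ennreal C) = null_distance M A g \<theta> f p q"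
    using C mult_divide_eq_ennreal[of "ennreal C" "null_distance M A g \<theta> f p q"]
    by (simp add: ennreal_times_divide mult.commute)
  ultimately show "null_distance M A g \<theta> f p q
      \<le> ennreal C * riemannian_distance M A (level_set M f t) (induced_metric A g f) p q"
    by (simp add: riemannian_distance_def)
qed

end
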